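(* Let $m,k_0>0$, $\omega^2=k_0/m$, let $g:\mathbb{R}\to\mathbb{R}$ be Lipschitz, and let $a\neq 0$. For $\varepsilon,\eta\in\mathbb{R}$ let $x=x(\cdot\,;a,\varepsilon,\eta)$ be the solution of $$x''+x+\varepsilon f(x,\eta,\varepsilon)=0,\quad f(x,\eta,\varepsilon)=-\eta x+(1-\varepsilon\eta)g(x),\qquad x(0)=a,\ x'(0)=0,$$ and set $$\mathcal{F}(a,\varepsilon,\eta)=\frac{\int_0^{2\pi}\cos(s)\,g(x(s))\,ds}{\int_0^{2\pi}\cos(s)\,x(s)\,ds}.$$ Then for every sufficiently large $R>0$ there are $\varepsilon_0>0$ and a constant $\kappa$ such that for $0<|\varepsilon|\le\varepsilon_0$ the function $\mathcal F(a,\varepsilon,\cdot)$ is well defined on $[-R,R]$ and: 1. if $|\eta|\le R$ and $x(\cdot\,;a,\varepsilon,\eta)$ is $2\pi$-periodic, then $\eta=(1-\varepsilon\eta)\,\mathcal{F}(a,\varepsilon,\eta)$; 2. for all $\eta_1,\eta_2\in[-R,R]$, $|\mathcal{F}(a,\varepsilon,\eta_2)-\mathcal{F}(a,\varepsilon,\eta_1)|\le |\varepsilon|\,\kappa\,|\eta_2-\eta_1|$; 3. for every $\eta^0\in[-R,R]$ the sequence $\eta^{j+1}=(1-\varepsilon\eta^{j})\,\mathcal{F}(a,\varepsilon,\eta^{j})$ is well defined and converges; for its limit $\eta$, the function $x(\cdot\,;a,\varepsilon,\eta)$ is $2\pi$-periodic, so that $\tilde x(t)=x(\omega_\varepsilon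 t)$, with $\frac1{\omega_\varepsilon^2}=\frac{1-\varepsilon\eta}{\omega^2}$, is a periodic solution with angular frequency $\omega_\varepsilon$ of $$m\ddot{\tilde x}+k_0\tilde x+\varepsilon k_0\, g(\tilde x)=0 .$$
   Context: A prime denotes $d/d\theta$ and a dot denotes $d/dt$, with $\theta=\omega_\varepsilon t$. "Period $T$" does not mean minimal period. *)

theory Defs
  imports "HOL-Analysis.Analysis"
begin

definition second_order_derivs :: "(real \<Rightarrow> real) \<Rightarrow> (real \<Rightarrow> real) \<Rightarrow> (real \<Rightarrow> real) \<Rightarrow> bool" where
  "second_order_derivs x x' x'' \<longleftrightarrow>
     (\<forall>t. (x has_real_derivative x' t) (at t) \<and> (x' has_real_derivative x'' t) (at t))"

definition pert :: "(real \<Rightarrow> real) \<Rightarrow> real \<Rightarrow> real \<Rightarrow> real \<Rightarrow> real" where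
  "pert g x \<eta> \<epsilon> = - \<eta> * x + (1 - \<epsilon> * \<eta>) * g x"

definition solves_ivp ::
  "(real \<Rightarrow> real) \<Rightarrow> real \<Rightarrow> real \<Rightarrow> real \<Rightarrow> (real \<Rightarrow> real) \<Rightarrow> bool" where
  "solves_ivp g a \<epsilon> \<eta> x \<longleftrightarrow>
     (\<exists>x' x''. second_order_derivs x x' x'' \<and>
        (\<forall>\<theta>. x'' \<theta> + x \<theta> + \<epsilon> * pert g (x \<theta>) \<eta> \<epsilon> = 0) \<and>
        x 0 = a \<and> x' 0 = 0)"

definition sol :: "(real \<Rightarrow> real) \<Rightarrow> real \<Rightarrow> real \<Rightarrow> real \<Rightarrow> real \<Rightarrow> real" where
  "sol g a \<epsilon> \<eta> = (THE x. solves_ivp g a \<epsilon> \<eta> x)"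

definition Fquot :: "(real \<Rightarrow> real) \<Rightarrow> real \<Rightarrow> real \<Rightarrow> real \<Rightarrow> real" where
  "Fquot g a \<epsilon> \<eta> =
     integral {0..2*pi} (\<lambda>s. cos s * g (sol g a \<epsilon> \<eta> s)) /
     integral {0..2*pi} (\<lambda>s. cos s * sol g a \<epsilon> \<eta> s)"

text \<open>\<^const>\<open>sol\<close>, \<^const>\<open>integral\<close> and division are total in HOL; the following predicate says that
  none of them takes a default value in \<^const>\<open>Fquot\<close>.\<close>

definition Fquot_well_defined :: "(real \<Rightarrow> real) \<Rightarrow> real \<Rightarrow> real \<Rightarrow> real \<Rightarrow> bool" where
  "Fquot_well_defined g a \<epsilon> \<eta> \<longleftrightarrow>
     (\<exists>!x. solves_ivp g a \<epsilon> \<eta> x) \<and>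
     (\<lambda>s. cos s * g (sol g a \<epsilon> \<eta> s)) integrable_on {0..2*pi} \<and>
     (\<lambda>s. cos s * sol g a \<epsilon> \<eta> s) integrable_on {0..2*pi} \<and>
     integral {0..2*pi} (\<lambda>s. cos s * sol g a \<epsilon> \<eta> s) \<noteq> 0"

text \<open>\<open>T\<close> need not be the minimal period.\<close>

definition has_period :: "real \<Rightarrow> (real \<Rightarrow> real) \<Rightarrow> bool" where
  "has_period T x \<longleftrightarrow> (\<forall>t. x (t + T) = x t)"

definition solves_oscillator ::
  "real \<Rightarrow> real \<Rightarrow> (real \<Rightarrow> real) \<Rightarrow> real \<Rightarrow> (real \<Rightarrow> real) \<Rightarrow> bool" where
  "solves_oscillator m k\<^sub>0 g \<epsilon> y \<longleftrightarrow>
     (\<exists>y' y''. second_order_derivs y y' y'' \<and>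
        (\<forall>t. m * y'' t + k\<^sub>0 * y t + \<epsilon> * k\<^sub>0 * g (y t) = 0))"

end

theory Submission
  imports Defs
begin

text \<open>
Write \<open>x\<^sub>\<eta>\<close> for the solution with frequency parameter \<open>\<eta>\<close>, and \<open>N\<close>, \<open>D\<close> for the numerator and denominator
of the quotient \<open>F = N / D\<close>. Multiplying the equation by \<open>cos\<close> and integrating over \<open>[0, 2\<pi>]\<close> gives
\<open>x\<^sub>\<eta>'(2\<pi>) = - \<epsilon> ((1 - \<epsilon>\<eta>) N - \<eta> D)\<close> (lemma \<open>resonance_identity\<close>), so the fixed-point equation
\<open>\<eta> = (1 - \<epsilon>\<eta>) F(\<eta>)\<close> says exactly that the velocity vanishes after time \<open>2\<pi>\<close>. A periodic solution
has this property because its initial velocity is zero. The converse is the point of the proof: one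
scalar condition has to force both the position and the velocity to return. It does so because the
equation is conservative. The energy has the same value at times \<open>0\<close> and \<open>2\<pi>\<close>, both velocities are
zero, hence \<open>x\<^sub>\<eta>(2\<pi>)\<close> and \<open>a\<close> have equal potential; for small \<open>\<epsilon>\<close> they are close to each other and the
potential is strictly monotone near \<open>a \<noteq> 0\<close>, so they coincide (\<open>returns_if_velocity_zero\<close>). Uniqueness
for the initial value problem then turns the return into periodicity (\<open>periodic_iff\<close>).

It remains to see that \<open>\<Phi>(\<eta>) = (1 - \<epsilon>\<eta>) F(\<eta>)\<close> is a contraction of \<open>[-R, R]\<close>. A single energy estimate for
the harmonic oscillator with a small forcing (\<open>forced_oscillator_bound\<close>) yields both
\<open>x\<^sub>\<eta> = a cos + O(\<epsilon>)\<close> and \<open>x\<^sub>\<eta>\<^sub>2 - x\<^sub>\<eta>\<^sub>1 = O(\<epsilon> \<bar>\<eta>\<^sub>2 - \<eta>\<^sub>1\<bar>)\<close> on \<open>[0, 2\<pi>]\<close>. The first makes \<open>D\<close> close to \<open>\<pi>a\<close>, so that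
\<open>F\<close> is well defined and bounded by a constant \<open>Fmax\<close> which depends only on \<open>g\<close> and \<open>a\<close>; hence \<open>R \<ge> 2 Fmax\<close>
suffices for \<open>\<Phi>\<close> to map \<open>[-R, R]\<close> into itself once \<open>\<bar>\<epsilon>\<bar>R \<le> 1/2\<close>. The second gives the Lipschitz bound of
order \<open>\<epsilon>\<close> for \<open>F\<close>, and with it the contraction.

Solutions exist on the whole line and are unique because the equation is autonomous and globally
Lipschitz: existence is Banach's fixed-point theorem in a space of functions of growth \<open>cosh (K t)\<close>
(\<open>second_order_ivp_exists\<close>), uniqueness is the same energy estimate, applied to the difference of two solutions.
\<close>

section \<open>Integration on the whole line\<close>

text \<open>Bounding an iterated primitive by comparing derivatives works for both signs of \<open>t\<close> at once, whereas
an estimate of \<open>\<integral>\<^sub>0\<^sup>t\<close> under the integral sign would need a case distinction on the sign at each step.\<close>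

lemma abs_le_of_deriv_le:
  fixes F G :: "real \<Rightarrow> real"
  assumes F: "\<And>t. (F has_real_derivative f t) (at t)"
    and G: "\<And>t. (G has_real_derivative g t) (at t)"
    and zero: "F 0 = 0" "G 0 = 0"
    and le: "\<And>t. \<bar>f t\<bar> \<le> g t"
  shows "\<bar>F t\<bar> \<le> \<bar>G t\<bar>"
proof -
  have mono: "G s - F s \<le> G t - F t \<and> G s + F s \<le> G t + F t" if "s \<le> t" for s t
  proof
    show "G s - F s \<le> G t - F t"
    proof (rule DERIV_nonneg_imp_nondecreasing[OF that])
      fix u
      show "\<exists>y. ((\<lambda>u. G u - F u) has_real_derivative y) (at u) \<and> 0 \<le> y"
        using le[of u] by (intro exI[of _ "g u - f u"] conjI DERIV_diff F G) auto
    qed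
    show "G s + F s \<le> G t + F t"
    proof (rule DERIV_nonneg_imp_nondecreasing[OF that])
      fix u
      show "\<exists>y. ((\<lambda>u. G u + F u) has_real_derivative y) (at u) \<and> 0 \<le> y"
        using le[of u] by (intro exI[of _ "g u + f u"] conjI DERIV_add F G) auto
    qed
  qed
  show ?thesis
  proof (cases "t \<ge> 0")
    case True
    then show ?thesis using mono[of 0 t] zero by auto
  next
    case False
    then show ?thesis using mono[of t 0] zero by auto
  qed
qed

text \<open>The choice is in fact unique for continuous \<open>f\<close>: this is \<open>\<integral>\<^sub>0\<^sup>t f\<close>, with the usual sign convention
for \<open>t < 0\<close>.\<close>

definition primitive :: "(real \<Rightarrow> real) \<Rightarrow> real \<Rightarrow> real" where
  "primitive f = (SOME F. F 0 = 0 \<and> (\<forall>t. (F has_real_derivative f t) (at t)))"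

lemma primitive:
  assumes "continuous_on UNIV f"
  shows primitive_0: "primitive f 0 = 0"
    and has_derivative_primitive: "(primitive f has_real_derivative f t) (at t)"
proof -
  have "\<exists>F. \<forall>x::real. -\<infinity> < ereal x \<longrightarrow> ereal x < \<infinity> \<longrightarrow> (F has_vector_derivative f x) (at x)"
    using assms by (intro einterval_antiderivative) (auto simp: continuous_on_eq_continuous_at)
  then obtain F where "\<And>x. (F has_real_derivative f x) (at x)"
    by (auto simp: has_real_derivative_iff_has_vector_derivative)
  then have "\<exists>F. F 0 = 0 \<and> (\<forall>t. (F has_real_derivative f t) (at t))"
    by (intro exI[of _ "\<lambda>t. F t - F 0"]) (auto intro!: derivative_eq_intros)
  from someI_ex[OF this]
  show "primitive f 0 = 0" "(primitive f has_real_derivative f t) (at t)"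
    unfolding primitive_def by blast+
qed

lemma continuous_on_has_real_derivative:
  assumes "\<And>t. (x has_real_derivative x' t) (at t)"
  shows "continuous_on A x"
  using assms by (meson DERIV_isCont continuous_at_imp_continuous_on)

section \<open>Global solutions of second-order equations\<close>

text \<open>Integrating \<open>cosh (K t)\<close> gives \<open>sinh (K t) / K\<close>, which \<open>cosh (K t) / K\<close> dominates. So each integration
gains a factor \<open>1 / K\<close> in the norm weighted by \<open>cosh (K t)\<close>. The weight is smooth at \<open>0\<close>, unlike
\<open>exp (K \<bar>t\<bar>)\<close>, so that derivatives can be compared on the whole line.\<close>

lemma double_integral_cosh_bound:
  fixes F F' r :: "real \<Rightarrow> real"
  assumes K: "K > 0"
    and F: "\<And>t. (F has_real_derivative F' t) (at t)" "F 0 = 0"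
    and F': "\<And>t. (F' has_real_derivative r t) (at t)" "F' 0 = 0"
    and r: "\<And>t. \<bar>r t\<bar> \<le> N * cosh (K * t)"
  shows "\<bar>F t\<bar> \<le> N / K\<^sup>2 * cosh (K * t)"
proof -
  have N: "0 \<le> N" using r[of 0] by simp
  have sinh_le: "\<bar>c * sinh (K * t)\<bar> \<le> c * cosh (K * t)" if "c \<ge> 0" for c t
  proof -
    have "\<bar>sinh (K * t)\<bar> \<le> cosh (K * t)"
      using sinh_le_cosh_real[of "K * t"] sinh_le_cosh_real[of "- (K * t)"] by (simp add: abs_le_iff)
    then show ?thesis using that by (simp add: abs_mult mult_left_mono)
  qed
  have deriv: "((\<lambda>t. c / K * sinh (K * t)) has_real_derivative c * cosh (K * t)) (at t)" for c t
    using K by (auto intro!: derivative_eq_intros)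
  have "\<bar>F' t\<bar> \<le> N / K * cosh (K * t)" for t
  proof -
    have "\<bar>F' t\<bar> \<le> \<bar>N / K * sinh (K * t)\<bar>"
      by (rule abs_le_of_deriv_le[OF F'(1) deriv F'(2) _ r]) simp
    also have "\<dots> \<le> N / K * cosh (K * t)" using N K by (intro sinh_le) auto
    finally show ?thesis .
  qed
  then have "\<bar>F t\<bar> \<le> \<bar>N / K / K * sinh (K * t)\<bar>"
    by (intro abs_le_of_deriv_le[OF F(1) deriv F(2)]) simp_all
  also have "\<dots> \<le> N / K / K * cosh (K * t)" using N K by (intro sinh_le) auto
  finally show ?thesis by (simp add: power2_eq_square)
qed

text \<open>The problem is equivalent to \<open>x = a + \<integral>\<integral> h(x)\<close>. On functions of the form \<open>cosh (K t) u(t)\<close> with \<open>u\<close> bounded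
and continuous, the right-hand side is a contraction with factor \<open>L / K\<^sup>2\<close> in the supremum norm of \<open>u\<close>.
Hence for \<open>K = L + 1\<close> one application of Banach's theorem produces a solution on the whole line, with no
continuation from short intervals.\<close>

theorem second_order_ivp_exists:
  fixes h :: "real \<Rightarrow> real"
  assumes lip: "L-lipschitz_on UNIV h"
  obtains x x' where "second_order_derivs x x' (\<lambda>t. h (x t))" "x 0 = a" "x' 0 = 0"
proof -
  define K where "K = L + 1"
  have L: "L \<ge> 0" using lip by (rule lipschitz_on_nonneg)
  then have K: "K > 0" by (simp add: K_def)
  have hlip: "\<bar>h x - h y\<bar> \<le> L * \<bar>x - y\<bar>" for x y
    using lipschitz_onD[OF lip, of x y] by (simp add: dist_real_def)
  have contr: "L / K\<^sup>2 < 1"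
  proof -
    have "0 \<le> L * L" using L by simp
    then have "L < K * K" using L unfolding K_def distrib_left distrib_right by linarith
    then show ?thesis using K by (simp add: power2_eq_square)
  qed
  \<comment> \<open>The unknown is \<open>u\<close>; \<open>w u\<close> is the candidate solution, \<open>II u\<close> the double primitive of \<open>h (w u)\<close>.\<close>
  define w where "w u t = cosh (K * t) * apply_bcontfun u t" for u :: "real \<Rightarrow>\<^sub>C real" and t
  define I where "I u = primitive (\<lambda>t. h (w u t))" for u :: "real \<Rightarrow>\<^sub>C real"
  define II where "II u = primitive (I u)" for u :: "real \<Rightarrow>\<^sub>C real"
  have cont_w: "continuous_on UNIV (\<lambda>t. h (w u t))" for u
    unfolding w_def
    by (intro continuous_on_compose2[OF lipschitz_on_continuous_on[OF lip]] continuous_intros) auto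
  have I: "(I u has_real_derivative h (w u t)) (at t)" "I u 0 = 0" for u t
    unfolding I_def by (rule has_derivative_primitive primitive_0, rule cont_w)+
  have II: "(II u has_real_derivative I u t) (at t)" "II u 0 = 0" for u t
    unfolding II_def
    by (rule has_derivative_primitive primitive_0, rule continuous_on_has_real_derivative, rule I)+
  define T where "T u t = (a + II u t) / cosh (K * t)" for u t
  have T_bcontfun: "T u \<in> bcontfun" for u
  proof -
    obtain N where N: "\<And>t. \<bar>apply_bcontfun u t\<bar> \<le> N"
      using bounded_apply_bcontfun[of u] by (auto simp: bounded_iff)
    have "\<bar>h (w u t)\<bar> \<le> (\<bar>h 0\<bar> + L * N) * cosh (K * t)" for t
    proof -
      have "\<bar>h (w u t)\<bar> \<le> \<bar>h 0\<bar> + L * \<bar>w u t\<bar>" using hlip[of "w u t" 0] by simp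
      also have "\<bar>h 0\<bar> \<le> \<bar>h 0\<bar> * cosh (K * t)"
        using cosh_real_ge_1[of "K * t"] mult_left_mono[of 1 "cosh (K * t)" "\<bar>h 0\<bar>"] by simp
      also have "L * \<bar>w u t\<bar> \<le> L * (cosh (K * t) * N)"
        using L unfolding w_def by (intro mult_left_mono) (simp_all add: abs_mult mult_left_mono N)
      finally show ?thesis by (simp add: algebra_simps)
    qed
    from double_integral_cosh_bound[OF K II I this]
    have bd: "\<bar>II u t\<bar> \<le> (\<bar>h 0\<bar> + L * N) / K\<^sup>2 * cosh (K * t)" for t .
    show ?thesis
    proof (rule bcontfun_normI)
      show "continuous_on UNIV (T u)"
        unfolding T_def
        by (intro continuous_intros continuous_on_has_real_derivative[OF II(1)])
           (auto simp: less_imp_neq[symmetric])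
    next
      fix t
      have "\<bar>a\<bar> \<le> \<bar>a\<bar> * cosh (K * t)"
        using cosh_real_ge_1[of "K * t"] mult_left_mono[of 1 "cosh (K * t)" "\<bar>a\<bar>"] by simp
      then have "\<bar>a + II u t\<bar> \<le> (\<bar>a\<bar> + (\<bar>h 0\<bar> + L * N) / K\<^sup>2) * cosh (K * t)"
        using bd[of t] by (simp add: distrib_right)
      then show "norm (T u t) \<le> \<bar>a\<bar> + (\<bar>h 0\<bar> + L * N) / K\<^sup>2"
        by (simp add: T_def pos_divide_le_eq)
    qed
  qed
  have "\<exists>!u. Bcontfun (T u) = u"
  proof (rule banach_fix_type)
    show "0 \<le> L / K\<^sup>2" using L by simp
    show "L / K\<^sup>2 < 1" by (rule contr)
    show "\<forall>u v. dist (Bcontfun (T u)) (Bcontfun (T v)) \<le> L / K\<^sup>2 * dist u v"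
    proof (intro allI dist_bound)
      fix u v :: "real \<Rightarrow>\<^sub>C real" and t
      have "\<bar>h (w u t) - h (w v t)\<bar> \<le> L * dist u v * cosh (K * t)" for t
      proof -
        have "\<bar>h (w u t) - h (w v t)\<bar> \<le> L * \<bar>w u t - w v t\<bar>" by (rule hlip)
        also have "w u t - w v t = cosh (K * t) * (apply_bcontfun u t - apply_bcontfun v t)"
          by (simp add: w_def algebra_simps)
        also have "L * \<bar>\<dots>\<bar> \<le> L * (cosh (K * t) * dist u v)"
          using L dist_bounded[of u t v]
          by (intro mult_left_mono) (simp_all add: abs_mult dist_real_def mult_left_mono)
        finally show ?thesis by (simp add: algebra_simps)
      qed
      then have "\<bar>II u t - II v t\<bar> \<le> L * dist u v / K\<^sup>2 * cosh (K * t)"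
        by (intro double_integral_cosh_bound[OF K, where F = "\<lambda>t. II u t - II v t"
              and F' = "\<lambda>t. I u t - I v t" and r = "\<lambda>t. h (w u t) - h (w v t)"]
            DERIV_diff I II) (simp_all add: I II)
      moreover have "T u t - T v t = (II u t - II v t) / cosh (K * t)"
        by (simp add: T_def diff_divide_distrib[symmetric])
      ultimately have "dist (T u t) (T v t) \<le> L / K\<^sup>2 * dist u v"
        by (simp add: dist_real_def pos_divide_le_eq)
      then show "dist (apply_bcontfun (Bcontfun (T u)) t) (apply_bcontfun (Bcontfun (T v)) t)
          \<le> L / K\<^sup>2 * dist u v"
        by (simp add: Bcontfun_inverse T_bcontfun)
    qed
  qed
  then obtain u where "Bcontfun (T u) = u" by blast
  then have "apply_bcontfun u = T u" by (metis Bcontfun_inverse T_bcontfun)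
  then have w: "w u t = a + II u t" for t by (simp add: w_def T_def)
  have "(w u has_real_derivative I u t) (at t)" for t
  proof -
    have "w u = (\<lambda>t. a + II u t)" using w by (rule ext)
    then show ?thesis by (auto intro!: derivative_eq_intros II)
  qed
  then have "second_order_derivs (w u) (I u) (\<lambda>t. h (w u t))"
    unfolding second_order_derivs_def using I by blast
  then show ?thesis by (rule that) (simp_all add: w II I)
qed

section \<open>The forced harmonic oscillator\<close>

text \<open>The energy \<open>d\<^sup>2 + d'\<^sup>2\<close> of the free oscillator has derivative \<open>2 d' r\<close>, because the terms in \<open>d d'\<close> cancel.
The products that the forcing bound produces are absorbed by \<open>2uv \<le> u\<^sup>2 + v\<^sup>2\<close>, and Gronwall's argument applies to
\<open>E = d\<^sup>2 + d'\<^sup>2 + B\<^sup>2\<close>, where the added \<open>B\<^sup>2\<close> makes the inequality homogeneous: \<open>E' \<le> (A + 1) E\<close>.\<close>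

lemma forced_oscillator_bound:
  fixes d d' r :: "real \<Rightarrow> real"
  assumes der: "second_order_derivs d d' (\<lambda>t. r t - d t)"
    and init: "d 0 = 0" "d' 0 = 0"
    and r: "\<And>t. 0 \<le> t \<Longrightarrow> t \<le> T \<Longrightarrow> \<bar>r t\<bar> \<le> A * \<bar>d t\<bar> + B"
    and "A \<ge> 0" "B \<ge> 0" and t: "0 \<le> t" "t \<le> T"
  shows "\<bar>d t\<bar> \<le> B * exp ((A + 1) * t / 2)"
proof -
  define E where "E t = (d t)\<^sup>2 + (d' t)\<^sup>2 + B\<^sup>2" for t
  have der': "(d has_real_derivative d' t) (at t)" "(d' has_real_derivative r t - d t) (at t)" for t
    using der by (auto simp: second_order_derivs_def)
  have E: "(E has_real_derivative 2 * d' t * r t) (at t)" for t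
    unfolding E_def by (auto intro!: derivative_eq_intros der' simp: algebra_simps)
  have "E t * exp (- ((A + 1) * t)) \<le> E 0 * exp (- ((A + 1) * 0))"
  proof (rule DERIV_nonpos_imp_nonincreasing[OF t(1)])
    fix s assume s: "0 \<le> s" "s \<le> t"
    have "2 * d' s * r s \<le> 2 * \<bar>d' s\<bar> * \<bar>r s\<bar>"
      by (metis abs_ge_self abs_mult abs_numeral)
    also have "\<dots> \<le> 2 * \<bar>d' s\<bar> * (A * \<bar>d s\<bar> + B)"
      using r[of s] s t by (intro mult_left_mono) auto
    also have "\<dots> = A * (2 * \<bar>d s\<bar> * \<bar>d' s\<bar>) + 2 * \<bar>d' s\<bar> * B" by (simp add: algebra_simps)
    also have "\<dots> \<le> A * ((d s)\<^sup>2 + (d' s)\<^sup>2) + ((d' s)\<^sup>2 + B\<^sup>2)"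
      using sum_squares_bound[of "\<bar>d s\<bar>" "\<bar>d' s\<bar>"] sum_squares_bound[of "\<bar>d' s\<bar>" B] \<open>A \<ge> 0\<close>
      by (intro add_mono mult_left_mono) auto
    also have "\<dots> \<le> (A + 1) * E s"
      using \<open>A \<ge> 0\<close> by (simp add: E_def algebra_simps)
    finally have le: "2 * d' s * r s \<le> (A + 1) * E s" .
    show "\<exists>y. ((\<lambda>t. E t * exp (- ((A + 1) * t))) has_real_derivative y) (at s) \<and> y \<le> 0"
    proof (intro exI conjI)
      show "((\<lambda>t. E t * exp (- ((A + 1) * t))) has_real_derivative
          (2 * d' s * r s - (A + 1) * E s) * exp (- ((A + 1) * s))) (at s)"
        by (auto intro!: derivative_eq_intros E simp: algebra_simps)
      show "(2 * d' s * r s - (A + 1) * E s) * exp (- ((A + 1) * s)) \<le> 0"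
        using le by (intro mult_nonpos_nonneg) auto
    qed
  qed
  then have "E t * exp (- ((A + 1) * t)) * exp ((A + 1) * t) \<le> B\<^sup>2 * exp ((A + 1) * t)"
    by (intro mult_right_mono) (simp_all add: E_def init)
  then have "E t \<le> B\<^sup>2 * exp ((A + 1) * t)"
    by (simp add: mult.assoc exp_add[symmetric])
  then have "(d t)\<^sup>2 \<le> B\<^sup>2 * exp ((A + 1) * t)"
    using zero_le_power2[of "d' t"] zero_le_power2[of B] unfolding E_def by linarith
  also have "\<dots> = (B * exp ((A + 1) * t / 2))\<^sup>2"
    by (simp add: power_mult_distrib exp_double[symmetric])
  finally show ?thesis
    using \<open>B \<ge> 0\<close> by (simp add: abs_le_square_iff[symmetric])
qed


text \<open>For \<open>A \<le> 1\<close> the exponent is at most \<open>2\<pi>\<close>, so the constant depends neither on the equation nor on \<open>\<epsilon>\<close>.\<close>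

corollary forced_oscillator_bound_period:
  assumes "second_order_derivs d d' (\<lambda>t. r t - d t)" "d 0 = 0" "d' 0 = 0"
    and "\<And>t. 0 \<le> t \<Longrightarrow> t \<le> 2 * pi \<Longrightarrow> \<bar>r t\<bar> \<le> A * \<bar>d t\<bar> + B"
    and A: "0 \<le> A" "A \<le> 1" and B: "0 \<le> B" and t: "0 \<le> t" "t \<le> 2 * pi"
  shows "\<bar>d t\<bar> \<le> exp (2 * pi) * B"
proof -
  have "\<bar>d t\<bar> \<le> B * exp ((A + 1) * t / 2)"
    by (rule forced_oscillator_bound[where d = d and d' = d' and r = r and T = "2 * pi"]) (use assms in auto)
  also have "(A + 1) * t \<le> 2 * (2 * pi)" using A t by (intro mult_mono) auto
  then have "B * exp ((A + 1) * t / 2) \<le> B * exp (2 * pi)" using B by (intro mult_left_mono) auto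
  finally show ?thesis by (simp add: mult.commute)
qed

section \<open>The perturbed oscillator\<close>

lemma solves_ivpE:
  assumes "solves_ivp g a \<epsilon> \<eta> x"
  obtains x' where "second_order_derivs x x' (\<lambda>t. - x t - \<epsilon> * pert g (x t) \<eta> \<epsilon>)" "x 0 = a" "x' 0 = 0"
proof -
  obtain x' x'' where x: "second_order_derivs x x' x''" "x 0 = a" "x' 0 = 0"
      "\<And>t. x'' t + x t + \<epsilon> * pert g (x t) \<eta> \<epsilon> = 0"
    using assms by (auto simp: solves_ivp_def)
  have "x'' = (\<lambda>t. - x t - \<epsilon> * pert g (x t) \<eta> \<epsilon>)"
    using x(4) by (intro ext) (simp add: algebra_simps eq_neg_iff_add_eq_0)
  with x that show ?thesis by simp
qed

lemma solves_ivpI: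
  assumes "second_order_derivs x x' (\<lambda>t. - x t - \<epsilon> * pert g (x t) \<eta> \<epsilon>)" "x 0 = a" "x' 0 = 0"
  shows "solves_ivp g a \<epsilon> \<eta> x"
  unfolding solves_ivp_def using assms by fastforce

text \<open>The equation has no velocity term and the initial velocity is zero. This reduces uniqueness for \<open>t < 0\<close> to
uniqueness for \<open>t \<ge> 0\<close>.\<close>

lemma solves_ivp_reflect:
  assumes "solves_ivp g a \<epsilon> \<eta> x"
  shows "solves_ivp g a \<epsilon> \<eta> (\<lambda>t. x (- t))"
proof -
  obtain x' where x: "second_order_derivs x x' (\<lambda>t. - x t - \<epsilon> * pert g (x t) \<eta> \<epsilon>)"
      "x 0 = a" "x' 0 = 0"
    using assms by (rule solves_ivpE)
  have "((\<lambda>t. x (- t)) has_real_derivative - x' (- t)) (at t)"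
    "((\<lambda>t. - x' (- t)) has_real_derivative - x (- t) - \<epsilon> * pert g (x (- t)) \<eta> \<epsilon>) (at t)" for t
  proof -
    have *: "(x has_real_derivative x' (- t)) (at (- t))"
      "(x' has_real_derivative - x (- t) - \<epsilon> * pert g (x (- t)) \<eta> \<epsilon>) (at (- t))"
      using x(1) by (auto simp: second_order_derivs_def)
    show "((\<lambda>t. x (- t)) has_real_derivative - x' (- t)) (at t)"
      using *(1) unfolding DERIV_mirror .
    show "((\<lambda>t. - x' (- t)) has_real_derivative - x (- t) - \<epsilon> * pert g (x (- t)) \<eta> \<epsilon>) (at t)"
      using DERIV_minus[OF *(2)[unfolded DERIV_mirror]] by (simp add: algebra_simps)
  qed
  then show ?thesis
    by (intro solves_ivpI[where x' = "\<lambda>t. - x' (- t)"]) (auto simp: second_order_derivs_def x)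
qed

lemma solves_ivp_shift:
  assumes x: "second_order_derivs x x' (\<lambda>t. - x t - \<epsilon> * pert g (x t) \<eta> \<epsilon>)"
    and "x T = a" "x' T = 0"
  shows "solves_ivp g a \<epsilon> \<eta> (\<lambda>t. x (t + T))"
proof -
  have "((\<lambda>t. x (t + T)) has_real_derivative x' (t + T)) (at t)"
    "((\<lambda>t. x' (t + T)) has_real_derivative - x (t + T) - \<epsilon> * pert g (x (t + T)) \<eta> \<epsilon>) (at t)" for t
    unfolding DERIV_shift[symmetric] using x by (auto simp: second_order_derivs_def)
  then show ?thesis
    using assms by (intro solves_ivpI[where x' = "\<lambda>t. x' (t + T)"]) (auto simp: second_order_derivs_def)
qed

lemma pert_lipschitz:
  assumes "L-lipschitz_on UNIV g"
  shows "\<bar>pert g x \<eta> \<epsilon> - pert g y \<eta> \<epsilon>\<bar> \<le> (\<bar>\<eta>\<bar> + \<bar>1 - \<epsilon> * \<eta>\<bar> * L) * \<bar>x - y\<bar>"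
proof -
  have "\<bar>g x - g y\<bar> \<le> L * \<bar>x - y\<bar>"
    using lipschitz_onD[OF assms, of x y] by (simp add: dist_real_def)
  then have "\<bar>(1 - \<epsilon> * \<eta>) * (g x - g y)\<bar> \<le> \<bar>1 - \<epsilon> * \<eta>\<bar> * (L * \<bar>x - y\<bar>)"
    unfolding abs_mult by (rule mult_left_mono) simp
  moreover have "pert g x \<eta> \<epsilon> - pert g y \<eta> \<epsilon> = - \<eta> * (x - y) + (1 - \<epsilon> * \<eta>) * (g x - g y)"
    by (simp add: pert_def algebra_simps)
  then have "\<bar>pert g x \<eta> \<epsilon> - pert g y \<eta> \<epsilon>\<bar> \<le> \<bar>- \<eta> * (x - y)\<bar> + \<bar>(1 - \<epsilon> * \<eta>) * (g x - g y)\<bar>"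
    by (simp only: abs_triangle_ineq)
  moreover have "\<bar>- \<eta> * (x - y)\<bar> = \<bar>\<eta>\<bar> * \<bar>x - y\<bar>" by (simp only: abs_mult abs_minus_cancel)
  ultimately show ?thesis by (simp only: distrib_right mult.assoc)
qed

text \<open>The difference of two solutions is an oscillator forced by at most a multiple of itself, that is, with
\<open>B = 0\<close> in the energy estimate.\<close>

lemma solves_ivp_unique_forward:
  assumes lip: "L-lipschitz_on UNIV g"
    and "solves_ivp g a \<epsilon> \<eta> x" "solves_ivp g a \<epsilon> \<eta> y" "0 \<le> t"
  shows "x t = y t"
proof -
  obtain x' where x: "second_order_derivs x x' (\<lambda>t. - x t - \<epsilon> * pert g (x t) \<eta> \<epsilon>)"
      "x 0 = a" "x' 0 = 0"
    using assms(2) by (rule solves_ivpE)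
  obtain y' where y: "second_order_derivs y y' (\<lambda>t. - y t - \<epsilon> * pert g (y t) \<eta> \<epsilon>)"
      "y 0 = a" "y' 0 = 0"
    using assms(3) by (rule solves_ivpE)
  let ?r = "\<lambda>t. - \<epsilon> * (pert g (x t) \<eta> \<epsilon> - pert g (y t) \<eta> \<epsilon>)"
  let ?A = "\<bar>\<epsilon>\<bar> * (\<bar>\<eta>\<bar> + \<bar>1 - \<epsilon> * \<eta>\<bar> * L)"
  have "\<bar>x t - y t\<bar> \<le> 0 * exp ((?A + 1) * t / 2)"
  proof (rule forced_oscillator_bound[where d = "\<lambda>t. x t - y t" and d' = "\<lambda>t. x' t - y' t" and T = t and r = ?r])
    show "second_order_derivs (\<lambda>t. x t - y t) (\<lambda>t. x' t - y' t) (\<lambda>t. ?r t - (x t - y t))"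
      using x(1) y(1) unfolding second_order_derivs_def
      by (auto intro!: derivative_eq_intros simp: algebra_simps)
    show "\<bar>?r s\<bar> \<le> ?A * \<bar>x s - y s\<bar> + 0" for s
      using mult_left_mono[OF pert_lipschitz[OF lip, of "x s" \<eta> \<epsilon> "y s"], of "\<bar>\<epsilon>\<bar>"]
      by (simp add: abs_mult mult.assoc)
    show "?A \<ge> 0" using lipschitz_on_nonneg[OF lip] by simp
  qed (use x y assms in simp_all)
  then show ?thesis by simp
qed

lemma solves_ivp_ex1:
  assumes lip: "L-lipschitz_on UNIV g"
  shows "\<exists>!x. solves_ivp g a \<epsilon> \<eta> x"
proof (rule ex_ex1I)
  define h where "h x = - x - \<epsilon> * pert g x \<eta> \<epsilon>" for x
  have "(1 + \<bar>\<epsilon>\<bar> * (\<bar>\<eta>\<bar> + \<bar>1 - \<epsilon> * \<eta>\<bar> * L))-lipschitz_on UNIV h"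
  proof (rule lipschitz_onI)
    fix x y
    have "h x - h y = - (x - y) - \<epsilon> * (pert g x \<eta> \<epsilon> - pert g y \<eta> \<epsilon>)"
      by (simp add: h_def algebra_simps)
    also have "\<bar>\<dots>\<bar> \<le> \<bar>x - y\<bar> + \<bar>\<epsilon>\<bar> * \<bar>pert g x \<eta> \<epsilon> - pert g y \<eta> \<epsilon>\<bar>"
      unfolding abs_mult[symmetric] by linarith
    finally show "dist (h x) (h y) \<le> (1 + \<bar>\<epsilon>\<bar> * (\<bar>\<eta>\<bar> + \<bar>1 - \<epsilon> * \<eta>\<bar> * L)) * dist x y"
      using mult_left_mono[OF pert_lipschitz[OF lip, of x \<eta> \<epsilon> y], of "\<bar>\<epsilon>\<bar>"]
      by (simp add: dist_real_def algebra_simps)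
  qed (use lipschitz_on_nonneg[OF lip] in simp)
  then obtain x x' where "second_order_derivs x x' (\<lambda>t. h (x t))" "x 0 = a" "x' 0 = 0"
    by (rule second_order_ivp_exists)
  then have "solves_ivp g a \<epsilon> \<eta> x" unfolding h_def by (rule solves_ivpI)
  then show "\<exists>x. solves_ivp g a \<epsilon> \<eta> x" by blast
next
  fix x y assume xy: "solves_ivp g a \<epsilon> \<eta> x" "solves_ivp g a \<epsilon> \<eta> y"
  show "x = y"
  proof
    fix t
    show "x t = y t"
    proof (cases "t \<ge> 0")
      case True
      then show ?thesis by (rule solves_ivp_unique_forward[OF lip xy])
    next
      case False
      then show ?thesis
        using solves_ivp_unique_forward[OF lip xy[THEN solves_ivp_reflect], of "- t"] by simp
    qed
  qed
qed

lemma sol_solves_ivp: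
  assumes "L-lipschitz_on UNIV g"
  shows "solves_ivp g a \<epsilon> \<eta> (sol g a \<epsilon> \<eta>)"
  unfolding sol_def using solves_ivp_ex1[OF assms] by (rule theI')

lemma sol_eqI:
  assumes "L-lipschitz_on UNIV g" "solves_ivp g a \<epsilon> \<eta> x"
  shows "x = sol g a \<epsilon> \<eta>"
  using solves_ivp_ex1[OF assms(1)] sol_solves_ivp[OF assms(1)] assms(2) by blast

section \<open>Energy and resonance\<close>

text \<open>The equation reads \<open>x'' + (1 - \<epsilon>\<eta>) V'(x) = 0\<close> with \<open>V(y) = y\<^sup>2 / 2 + \<epsilon> G(y)\<close> and \<open>G' = g\<close>, so the energy
\<open>x'\<^sup>2 / 2 + (1 - \<epsilon>\<eta>) V(x)\<close> is constant. If the velocity vanishes at \<open>0\<close> and at \<open>T\<close> and \<open>\<epsilon>\<eta> \<noteq> 1\<close>, then \<open>V\<close> takes the same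
value at \<open>x(0)\<close> and \<open>x(T)\<close>. By the mean value theorem two distinct such points would enclose a zero of
\<open>V'(y) = y + \<epsilon> g(y)\<close>.\<close>

lemma returns_if_velocity_zero:
  assumes cont: "continuous_on UNIV g"
    and x: "second_order_derivs x x' (\<lambda>t. - x t - \<epsilon> * pert g (x t) \<eta> \<epsilon>)" "x' 0 = 0" "x' T = 0"
    and c: "\<epsilon> * \<eta> \<noteq> 1"
    and nz: "\<And>y. y \<in> closed_segment (x 0) (x T) \<Longrightarrow> y + \<epsilon> * g y \<noteq> 0"
  shows "x T = x 0"
proof (rule ccontr)
  assume ne: "x T \<noteq> x 0"
  define V where "V y = y\<^sup>2 / 2 + \<epsilon> * primitive g y" for y
  have V: "(V has_real_derivative y + \<epsilon> * g y) (at y)" for y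
    unfolding V_def by (auto intro!: derivative_eq_intros has_derivative_primitive cont)
  define H where "H t = (x' t)\<^sup>2 / 2 + (1 - \<epsilon> * \<eta>) * V (x t)" for t
  have "(H has_real_derivative 0) (at t)" for t
  proof -
    have *: "(x has_real_derivative x' t) (at t)"
        "(x' has_real_derivative - x t - \<epsilon> * pert g (x t) \<eta> \<epsilon>) (at t)"
      using x(1) by (auto simp: second_order_derivs_def)
    show ?thesis
      unfolding H_def
      by (auto intro!: derivative_eq_intros * DERIV_chain2[OF V] simp: pert_def field_simps)
  qed
  then have "H T = H 0" by (intro DERIV_isconst_all) blast
  with c have VV: "V (x T) = V (x 0)" by (simp add: H_def x)
  have "\<exists>z. z \<in> closed_segment (x 0) (x T) \<and> z + \<epsilon> * g z = 0"
  proof (cases "x 0 < x T")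
    case True
    obtain z where "x 0 < z" "z < x T" "V (x T) - V (x 0) = (x T - x 0) * (z + \<epsilon> * g z)"
      using MVT2[OF True V] by blast
    then have "z \<in> closed_segment (x 0) (x T) \<and> z + \<epsilon> * g z = 0"
      using VV True by (simp add: closed_segment_eq_real_ivl)
    then show ?thesis by blast
  next
    case False
    with ne have lt: "x T < x 0" by simp
    obtain z where "x T < z" "z < x 0" "V (x 0) - V (x T) = (x 0 - x T) * (z + \<epsilon> * g z)"
      using MVT2[OF lt V] by blast
    then have "z \<in> closed_segment (x 0) (x T) \<and> z + \<epsilon> * g z = 0"
      using VV lt by (simp add: closed_segment_eq_real_ivl)
    then show ?thesis by blast
  qed
  with nz show False by blast
qed

text \<open>The integrand is \<open>(x'' + x) cos\<close>, which is the derivative of \<open>x' cos + x sin\<close>: the kernel function \<open>cos\<close> of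
the unperturbed operator turns the equation into a boundary term.\<close>

lemma resonance_identity:
  assumes x: "second_order_derivs x x' (\<lambda>t. - x t - \<epsilon> * pert g (x t) \<eta> \<epsilon>)" "x' 0 = 0"
  shows "((\<lambda>s. - \<epsilon> * (cos s * pert g (x s) \<eta> \<epsilon>)) has_integral x' (2 * pi)) {0..2 * pi}"
proof -
  have *: "(x has_real_derivative x' t) (at t within A)"
      "(x' has_real_derivative - x t - \<epsilon> * pert g (x t) \<eta> \<epsilon>) (at t within A)" for t A
    using x(1) by (auto simp: second_order_derivs_def intro: has_field_derivative_at_within)
  have "((\<lambda>s. - \<epsilon> * (cos s * pert g (x s) \<eta> \<epsilon>)) has_integral
      (x' (2 * pi) * cos (2 * pi) + x (2 * pi) * sin (2 * pi)) - (x' 0 * cos 0 + x 0 * sin 0)) {0..2 * pi}"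
  proof (rule fundamental_theorem_of_calculus)
    fix s
    show "((\<lambda>s. x' s * cos s + x s * sin s) has_vector_derivative
        - \<epsilon> * (cos s * pert g (x s) \<eta> \<epsilon>)) (at s within {0..2 * pi})"
      unfolding has_real_derivative_iff_has_vector_derivative[symmetric]
      by (auto intro!: derivative_eq_intros * simp: algebra_simps)
  qed simp
  then show ?thesis using x by simp
qed

lemma has_integral_cos_squared: "((\<lambda>s. cos s * cos s) has_integral pi) {0..2 * pi}"
proof -
  have "((\<lambda>s. cos s * cos s) has_integral
      ((2 * pi + sin (2 * pi) * cos (2 * pi)) / 2 - (0 + sin 0 * cos 0) / 2)) {0..2 * pi}"
  proof (rule fundamental_theorem_of_calculus)
    fix s :: real
    have half: "(1 + (c - d)) / 2 = c" if "c + d = 1" for c d :: real using that by simp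
    have eq: "(1 + (cos s * cos s - sin s * sin s)) / 2 = cos s * cos s"
      by (rule half) simp
    have "((\<lambda>s. (s + sin s * cos s) / 2) has_real_derivative (1 + (cos s * cos s - sin s * sin s)) / 2)
        (at s within {0..2 * pi})"
      by (auto intro!: derivative_eq_intros)
    then show "((\<lambda>s. (s + sin s * cos s) / 2) has_vector_derivative cos s * cos s) (at s within {0..2 * pi})"
      unfolding eq has_real_derivative_iff_has_vector_derivative .
  qed simp
  then show ?thesis by simp
qed

lemma abs_integral_cos_le:
  assumes u: "\<And>s. 0 \<le> s \<Longrightarrow> s \<le> 2 * pi \<Longrightarrow> \<bar>u s\<bar> \<le> B" and "(\<lambda>s. cos s * u s) integrable_on {0..2 * pi}"
  shows "\<bar>integral {0..2 * pi} (\<lambda>s. cos s * u s)\<bar> \<le> 2 * pi * B"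
proof -
  have "norm (integral {0..2 * pi} (\<lambda>s. cos s * u s)) \<le> integral {0..2 * pi} (\<lambda>_. B)"
  proof (rule integral_norm_bound_integral)
    fix s assume "s \<in> {0..2 * pi}"
    then have "\<bar>u s\<bar> \<le> B" using u by simp
    then show "norm (cos s * u s) \<le> B"
      using mult_mono[of "\<bar>cos s\<bar>" 1 "\<bar>u s\<bar>" B] by (simp add: abs_mult)
  qed (use assms in \<open>simp_all add: integrable_const_ivl\<close>)
  then show ?thesis by simp
qed

section \<open>Iteration of a contraction\<close>

text \<open>Banach's theorem as a statement about a given orbit: the distance to the fixed point decays like \<open>c ^ j\<close>.\<close>

lemma iterates_converge_to_fixed_point:
  fixes \<Phi> :: "real \<Rightarrow> real"
  assumes S: "complete S" "h 0 \<in> S" and \<Phi>: "\<And>x. x \<in> S \<Longrightarrow> \<Phi> x \<in> S"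
    and contr: "\<And>x y. x \<in> S \<Longrightarrow> y \<in> S \<Longrightarrow> \<bar>\<Phi> x - \<Phi> y\<bar> \<le> c * \<bar>x - y\<bar>" and c: "0 \<le> c" "c < 1"
    and h: "\<And>j. h (Suc j) = \<Phi> (h j)"
  shows "\<forall>j. h j \<in> S" and "\<exists>x\<in>S. \<Phi> x = x \<and> h \<longlonglongrightarrow> x"
proof -
  show hS: "\<forall>j. h j \<in> S"
  proof
    show "h j \<in> S" for j by (induction j) (use S h \<Phi> in auto)
  qed
  have "\<exists>!x. x \<in> S \<and> \<Phi> x = x"
    using S \<Phi> contr c by (intro Banach_fix[where c = c]) (auto simp: dist_real_def)
  then obtain x where x: "x \<in> S" "\<Phi> x = x" by blast
  have "\<bar>h j - x\<bar> \<le> c ^ j * \<bar>h 0 - x\<bar>" for j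
  proof (induction j)
    case (Suc j)
    have "\<bar>h (Suc j) - x\<bar> \<le> c * \<bar>h j - x\<bar>"
      using contr[of "h j" x] hS x h by simp
    also have "\<dots> \<le> c * (c ^ j * \<bar>h 0 - x\<bar>)" using Suc c by (intro mult_left_mono)
    finally show ?case by simp
  qed simp
  moreover have "(\<lambda>j. c ^ j * \<bar>h 0 - x\<bar>) \<longlonglongrightarrow> 0"
    using c by (intro tendsto_mult_left_zero LIMSEQ_power_zero) simp
  ultimately have "(\<lambda>j. h j - x) \<longlonglongrightarrow> 0"
    by (intro Lim_null_comparison[where f = "\<lambda>j. h j - x" and g = "\<lambda>j. c ^ j * \<bar>h 0 - x\<bar>"]) auto
  then have "h \<longlonglongrightarrow> x" by (rule LIM_zero_cancel)
  with x show "\<exists>x\<in>S. \<Phi> x = x \<and> h \<longlonglongrightarrow> x" by blast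
qed


section \<open>Uniform estimates for weak coupling\<close>

locale lipschitz_nonlinearity =
  fixes g :: "real \<Rightarrow> real" and L a :: real
  assumes lip: "L-lipschitz_on UNIV g" and a: "a \<noteq> 0"
begin

text \<open>The constants that enter the conditions on \<open>R\<close> and \<open>\<epsilon>\<close>. In the regime of weak coupling defined below,
\<open>amp\<close> bounds \<open>\<bar>x\<^sub>\<eta>\<bar>\<close> on \<open>[0, 2\<pi>]\<close> and \<open>gmax\<close> bounds \<open>\<bar>g(x\<^sub>\<eta>)\<bar>\<close> there; \<open>Ccos R\<close> and \<open>Cpar\<close> are the constants
in \<open>x\<^sub>\<eta> = a cos + O(\<epsilon>)\<close> and in the dependence of \<open>x\<^sub>\<eta>\<close> on \<open>\<eta>\<close>; \<open>Fmax\<close> and \<open>kappa\<close> are the bound and, up to the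
factor \<open>\<epsilon>\<close>, the Lipschitz constant of the quotient. Only \<open>Ccos R\<close> depends on \<open>R\<close>: since \<open>amp\<close> absorbs the
error \<open>\<epsilon> Ccos R\<close> in the term \<open>1\<close>, the bound \<open>Fmax\<close> does not, and \<open>R \<ge> 2 Fmax\<close> is not circular.\<close>

definition amp :: real where "amp = \<bar>a\<bar> + 1"
definition gmax :: real where "gmax = \<bar>g 0\<bar> + L * amp"
definition Ccos :: "real \<Rightarrow> real" where "Ccos R = exp (2 * pi) * ((R + 2 * L) * \<bar>a\<bar> + 2 * \<bar>g 0\<bar>)"
definition Cpar :: real where "Cpar = exp (2 * pi) * (amp + gmax)"
definition Fmax :: real where "Fmax = 4 * gmax / \<bar>a\<bar>"
definition kappa :: real where "kappa = 4 * Cpar * (L + Fmax) / \<bar>a\<bar>"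

lemma constants_nonneg:
  "0 \<le> L" "0 \<le> amp" "0 \<le> gmax" "0 \<le> Cpar" "0 \<le> Fmax" "0 \<le> kappa" "0 \<le> R \<Longrightarrow> 0 \<le> Ccos R"
proof -
  show L: "0 \<le> L" using lip by (rule lipschitz_on_nonneg)
  show amp: "0 \<le> amp" by (simp add: amp_def)
  show gmax: "0 \<le> gmax" using L amp by (simp add: gmax_def)
  show Cpar: "0 \<le> Cpar" using amp gmax by (simp add: Cpar_def)
  show Fmax: "0 \<le> Fmax" using gmax by (simp add: Fmax_def)
  show "0 \<le> kappa" using Cpar Fmax L by (simp add: kappa_def)
  show "0 \<le> Ccos R" if "0 \<le> R" using L that by (simp add: Ccos_def)
qed

lemma lip_abs: "\<bar>g x - g y\<bar> \<le> L * \<bar>x - y\<bar>"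
  using lipschitz_onD[OF lip, of x y] by (simp add: dist_real_def)

lemma abs_g_le:
  assumes "\<bar>y\<bar> \<le> amp"
  shows "\<bar>g y\<bar> \<le> gmax"
proof -
  have "\<bar>g y - g 0\<bar> \<le> L * \<bar>y\<bar>" using lip_abs[of y 0] by simp
  also have "\<dots> \<le> L * amp" using assms constants_nonneg(1) by (rule mult_left_mono)
  finally show ?thesis unfolding gmax_def by linarith
qed

end

text \<open>The roles of the smallness conditions: \<open>eps_R\<close> keeps \<open>1 - \<epsilon>\<eta>\<close> in \<open>[1/2, 3/2]\<close>; \<open>eps_force\<close> makes the forcing
weak enough for the estimate on one period; \<open>eps_amp\<close> keeps the solutions below \<open>amp\<close>; \<open>eps_denom\<close> keeps the
denominator of the quotient away from zero; \<open>eps_energy\<close> makes the potential monotone between \<open>a\<close> and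
\<open>x\<^sub>\<eta>(2\<pi>)\<close>; \<open>eps_contr\<close> makes the fixed-point map a contraction with factor \<open>1/2\<close>.\<close>

locale weak_coupling = lipschitz_nonlinearity +
  fixes R \<epsilon> :: real
  assumes R: "0 \<le> R" "2 * Fmax \<le> R"
    and eps: "\<epsilon> \<noteq> 0" "\<bar>\<epsilon>\<bar> \<le> 1"
    and eps_R: "\<bar>\<epsilon>\<bar> * R \<le> 1 / 2"
    and eps_force: "\<bar>\<epsilon>\<bar> * (R + 2 * L) \<le> 1"
    and eps_amp: "\<bar>\<epsilon>\<bar> * Ccos R \<le> 1"
    and eps_denom: "\<bar>\<epsilon>\<bar> * Ccos R \<le> \<bar>a\<bar> / 4"
    and eps_energy: "\<bar>\<epsilon>\<bar> * (Ccos R + gmax) < \<bar>a\<bar>"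
    and eps_contr: "\<bar>\<epsilon>\<bar> * (Fmax + 2 * kappa) \<le> 1 / 2"

lemma (in lipschitz_nonlinearity) eventually_weak_coupling:
  assumes R: "0 \<le> R" "2 * Fmax \<le> R"
  shows "\<exists>\<epsilon>\<^sub>0>0. \<forall>\<epsilon>. 0 < \<bar>\<epsilon>\<bar> \<and> \<bar>\<epsilon>\<bar> \<le> \<epsilon>\<^sub>0 \<longrightarrow> weak_coupling g L a R \<epsilon>"
proof -
  have small: "eventually (\<lambda>e. e * c < b) (at_right 0)" if "b > 0" for b c :: real
  proof -
    have "((\<lambda>e::real. e * c) \<longlongrightarrow> 0 * c) (at_right 0)" by (intro tendsto_intros)
    then show ?thesis using that by (intro order_tendstoD) auto
  qed
  have "eventually (\<lambda>e. e * 1 < 1 \<and> e * R < 1 / 2 \<and> e * (R + 2 * L) < 1 \<and> e * Ccos R < 1 \<and>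
      e * Ccos R < \<bar>a\<bar> / 4 \<and> e * (Ccos R + gmax) < \<bar>a\<bar> \<and> e * (Fmax + 2 * kappa) < 1 / 2) (at_right 0)"
    using a by (intro eventually_conj small) auto
  then obtain b where b: "b > 0" and *: "\<And>e. 0 < e \<Longrightarrow> e < b \<Longrightarrow> e * 1 < 1 \<and> e * R < 1 / 2 \<and>
      e * (R + 2 * L) < 1 \<and> e * Ccos R < 1 \<and>
      e * Ccos R < \<bar>a\<bar> / 4 \<and> e * (Ccos R + gmax) < \<bar>a\<bar> \<and> e * (Fmax + 2 * kappa) < 1 / 2"
    unfolding eventually_at_right_field by blast
  have "weak_coupling g L a R \<epsilon>" if "0 < \<bar>\<epsilon>\<bar> \<and> \<bar>\<epsilon>\<bar> \<le> b / 2" for \<epsilon>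
    using *[of "\<bar>\<epsilon>\<bar>"] that b R by unfold_locales auto
  then show ?thesis using b by (intro exI[of _ "b / 2"]) auto
qed

context weak_coupling
begin

abbreviation x :: "real \<Rightarrow> real \<Rightarrow> real" where "x \<equiv> sol g a \<epsilon>"

lemma solution:
  obtains x' where "second_order_derivs (x \<eta>) x' (\<lambda>t. - x \<eta> t - \<epsilon> * pert g (x \<eta> t) \<eta> \<epsilon>)"
    "x \<eta> 0 = a" "x' 0 = 0"
  using sol_solves_ivp[OF lip] by (rule solves_ivpE)

lemma continuous_on_x: "continuous_on A (x \<eta>)"
proof -
  obtain x' where "second_order_derivs (x \<eta>) x' (\<lambda>t. - x \<eta> t - \<epsilon> * pert g (x \<eta> t) \<eta> \<epsilon>)"
    using solution by blast
  then show ?thesis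
    by (intro continuous_on_has_real_derivative[where x' = x']) (auto simp: second_order_derivs_def)
qed

lemma continuous_on_g: "continuous_on A g"
  using lipschitz_on_continuous_on[OF lip] continuous_on_subset by blast

lemma continuous_on_g_x: "continuous_on A (\<lambda>s. g (x \<eta> s))"
  by (rule continuous_on_compose2[OF continuous_on_g[of UNIV] continuous_on_x]) simp

lemma abs_eps_eta: "\<bar>\<eta>\<bar> \<le> R \<Longrightarrow> \<bar>\<epsilon> * \<eta>\<bar> \<le> 1 / 2"
  using eps_R mult_left_mono[of "\<bar>\<eta>\<bar>" R "\<bar>\<epsilon>\<bar>"] by (simp add: abs_mult)

lemma pert_factor_le:
  assumes "\<bar>\<eta>\<bar> \<le> R"
  shows "\<bar>\<eta>\<bar> + \<bar>1 - \<epsilon> * \<eta>\<bar> * L \<le> R + 2 * L"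
proof -
  have "\<bar>1 - \<epsilon> * \<eta>\<bar> \<le> 2" using abs_eps_eta[OF assms] by linarith
  then show ?thesis using assms constants_nonneg(1) by (intro add_mono mult_right_mono)
qed

lemma abs_pert_diff_le:
  assumes "\<bar>\<eta>\<bar> \<le> R"
  shows "\<bar>pert g y \<eta> \<epsilon> - pert g z \<eta> \<epsilon>\<bar> \<le> (R + 2 * L) * \<bar>y - z\<bar>"
  using pert_lipschitz[OF lip, of y \<eta> \<epsilon> z]
    mult_right_mono[OF pert_factor_le[OF assms], of "\<bar>y - z\<bar>"] by simp

lemma abs_pert_le:
  assumes "\<bar>\<eta>\<bar> \<le> R"
  shows "\<bar>pert g y \<eta> \<epsilon>\<bar> \<le> (R + 2 * L) * \<bar>y\<bar> + 2 * \<bar>g 0\<bar>"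
proof -
  have "\<bar>pert g y \<eta> \<epsilon> - pert g 0 \<eta> \<epsilon>\<bar> \<le> (R + 2 * L) * \<bar>y\<bar>"
    using abs_pert_diff_le[OF assms, of y 0] by simp
  moreover have "\<bar>pert g 0 \<eta> \<epsilon>\<bar> \<le> 2 * \<bar>g 0\<bar>"
  proof -
    have "\<bar>1 - \<epsilon> * \<eta>\<bar> \<le> 2" using abs_eps_eta[OF assms] by linarith
    then show ?thesis by (simp add: pert_def abs_mult mult_right_mono)
  qed
  ultimately show ?thesis by linarith
qed

text \<open>The difference solves a forced oscillator with zero initial data; bounding \<open>\<bar>x\<^sub>\<eta>\<bar>\<close> by \<open>\<bar>x\<^sub>\<eta> - a cos\<bar> + \<bar>a\<bar>\<close> in the
forcing puts it in the form \<open>A \<bar>d\<bar> + B\<close> without an a priori bound on the solution.\<close>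

lemma x_near_cos:
  assumes eta: "\<bar>\<eta>\<bar> \<le> R" and t: "0 \<le> t" "t \<le> 2 * pi"
  shows "\<bar>x \<eta> t - a * cos t\<bar> \<le> \<bar>\<epsilon>\<bar> * Ccos R"
proof -
  obtain x' where x': "second_order_derivs (x \<eta>) x' (\<lambda>t. - x \<eta> t - \<epsilon> * pert g (x \<eta> t) \<eta> \<epsilon>)"
    "x \<eta> 0 = a" "x' 0 = 0"
    by (rule solution)
  let ?B = "(R + 2 * L) * \<bar>a\<bar> + 2 * \<bar>g 0\<bar>"
  have RL: "0 \<le> R + 2 * L" using R constants_nonneg(1) by simp
  have "\<bar>x \<eta> t - a * cos t\<bar> \<le> exp (2 * pi) * (\<bar>\<epsilon>\<bar> * ?B)"
  proof (rule forced_oscillator_bound_period[where d = "\<lambda>t. x \<eta> t - a * cos t"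
        and d' = "\<lambda>t. x' t + a * sin t"
        and r = "\<lambda>t. - \<epsilon> * pert g (x \<eta> t) \<eta> \<epsilon>" and A = "\<bar>\<epsilon>\<bar> * (R + 2 * L)"])
    show "second_order_derivs (\<lambda>t. x \<eta> t - a * cos t) (\<lambda>t. x' t + a * sin t)
        (\<lambda>t. - \<epsilon> * pert g (x \<eta> t) \<eta> \<epsilon> - (x \<eta> t - a * cos t))"
      using x'(1) unfolding second_order_derivs_def
      by (auto intro!: derivative_eq_intros)
  next
    fix s
    have "\<bar>x \<eta> s\<bar> \<le> \<bar>x \<eta> s - a * cos s\<bar> + \<bar>a\<bar> * \<bar>cos s\<bar>" unfolding abs_mult[symmetric] by linarith
    also have "\<bar>a\<bar> * \<bar>cos s\<bar> \<le> \<bar>a\<bar>" by (simp add: mult_left_le)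
    finally have "(R + 2 * L) * \<bar>x \<eta> s\<bar> \<le> (R + 2 * L) * (\<bar>x \<eta> s - a * cos s\<bar> + \<bar>a\<bar>)"
      using RL by (intro mult_left_mono) auto
    then have "\<bar>pert g (x \<eta> s) \<eta> \<epsilon>\<bar> \<le> (R + 2 * L) * \<bar>x \<eta> s - a * cos s\<bar> + ?B"
      using abs_pert_le[OF eta, of "x \<eta> s"] by (simp add: distrib_left)
    from mult_left_mono[OF this, of "\<bar>\<epsilon>\<bar>"]
    show "\<bar>- \<epsilon> * pert g (x \<eta> s) \<eta> \<epsilon>\<bar> \<le> \<bar>\<epsilon>\<bar> * (R + 2 * L) * \<bar>x \<eta> s - a * cos s\<bar> + \<bar>\<epsilon>\<bar> * ?B"
      unfolding abs_mult abs_minus_cancel by (simp add: algebra_simps)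
  qed (use RL eps_force t x' in simp_all)
  then show ?thesis by (simp add: Ccos_def mult.left_commute)
qed

lemma abs_x_le:
  assumes "\<bar>\<eta>\<bar> \<le> R" "0 \<le> t" "t \<le> 2 * pi"
  shows "\<bar>x \<eta> t\<bar> \<le> amp"
proof -
  have "\<bar>a * cos t\<bar> \<le> \<bar>a\<bar>" by (simp add: abs_mult mult_left_le)
  then show ?thesis using x_near_cos[OF assms] eps_amp unfolding amp_def by linarith
qed

text \<open>Changing the state in the perturbation costs a multiple of the difference of the solutions (the term with
\<open>A\<close>); changing the parameter costs \<open>\<bar>x + \<epsilon> g(x)\<bar> \<bar>\<eta>\<^sub>2 - \<eta>\<^sub>1\<bar>\<close> (the term with \<open>B\<close>). The factor \<open>\<epsilon>\<close> in front of the
perturbation is what makes the Lipschitz constant of order \<open>\<epsilon>\<close>.\<close>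

lemma x_lipschitz_in_eta:
  assumes eta: "\<bar>\<eta>\<^sub>1\<bar> \<le> R" "\<bar>\<eta>\<^sub>2\<bar> \<le> R" and t: "0 \<le> t" "t \<le> 2 * pi"
  shows "\<bar>x \<eta>\<^sub>2 t - x \<eta>\<^sub>1 t\<bar> \<le> \<bar>\<epsilon>\<bar> * Cpar * \<bar>\<eta>\<^sub>2 - \<eta>\<^sub>1\<bar>"
proof -
  obtain x1 where x1: "second_order_derivs (x \<eta>\<^sub>1) x1 (\<lambda>t. - x \<eta>\<^sub>1 t - \<epsilon> * pert g (x \<eta>\<^sub>1 t) \<eta>\<^sub>1 \<epsilon>)"
    "x \<eta>\<^sub>1 0 = a" "x1 0 = 0"
    by (rule solution)
  obtain x2 where x2: "second_order_derivs (x \<eta>\<^sub>2) x2 (\<lambda>t. - x \<eta>\<^sub>2 t - \<epsilon> * pert g (x \<eta>\<^sub>2 t) \<eta>\<^sub>2 \<epsilon>)"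
    "x \<eta>\<^sub>2 0 = a" "x2 0 = 0"
    by (rule solution)
  have RL: "0 \<le> R + 2 * L" using R constants_nonneg(1) by simp
  let ?r = "\<lambda>t. - \<epsilon> * (pert g (x \<eta>\<^sub>2 t) \<eta>\<^sub>2 \<epsilon> - pert g (x \<eta>\<^sub>1 t) \<eta>\<^sub>1 \<epsilon>)"
  let ?B = "(amp + gmax) * \<bar>\<eta>\<^sub>2 - \<eta>\<^sub>1\<bar>"
  have "\<bar>x \<eta>\<^sub>2 t - x \<eta>\<^sub>1 t\<bar> \<le> exp (2 * pi) * (\<bar>\<epsilon>\<bar> * ?B)"
  proof (rule forced_oscillator_bound_period[where d = "\<lambda>t. x \<eta>\<^sub>2 t - x \<eta>\<^sub>1 t"
        and d' = "\<lambda>t. x2 t - x1 t"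
        and r = ?r and A = "\<bar>\<epsilon>\<bar> * (R + 2 * L)"])
    show "second_order_derivs (\<lambda>t. x \<eta>\<^sub>2 t - x \<eta>\<^sub>1 t) (\<lambda>t. x2 t - x1 t) (\<lambda>t. ?r t - (x \<eta>\<^sub>2 t - x \<eta>\<^sub>1 t))"
      using x1(1) x2(1) unfolding second_order_derivs_def
      by (auto intro!: derivative_eq_intros simp: algebra_simps)
  next
    fix s assume s: "0 \<le> s" "s \<le> 2 * pi"
    have "pert g (x \<eta>\<^sub>1 s) \<eta>\<^sub>2 \<epsilon> - pert g (x \<eta>\<^sub>1 s) \<eta>\<^sub>1 \<epsilon> = - (x \<eta>\<^sub>1 s + \<epsilon> * g (x \<eta>\<^sub>1 s)) * (\<eta>\<^sub>2 - \<eta>\<^sub>1)"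
      by (simp add: pert_def algebra_simps)
    also have "\<bar>\<dots>\<bar> = \<bar>x \<eta>\<^sub>1 s + \<epsilon> * g (x \<eta>\<^sub>1 s)\<bar> * \<bar>\<eta>\<^sub>2 - \<eta>\<^sub>1\<bar>"
      by (simp only: abs_mult abs_minus_cancel)
    also have "\<bar>x \<eta>\<^sub>1 s + \<epsilon> * g (x \<eta>\<^sub>1 s)\<bar> \<le> \<bar>x \<eta>\<^sub>1 s\<bar> + \<bar>\<epsilon>\<bar> * \<bar>g (x \<eta>\<^sub>1 s)\<bar>"
      unfolding abs_mult[symmetric] by linarith
    also have "\<dots> \<le> amp + 1 * gmax"
      using abs_x_le[OF eta(1) s] abs_g_le eps by (intro add_mono mult_mono) auto
    finally have "\<bar>pert g (x \<eta>\<^sub>1 s) \<eta>\<^sub>2 \<epsilon> - pert g (x \<eta>\<^sub>1 s) \<eta>\<^sub>1 \<epsilon>\<bar> \<le> ?B"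
      by (simp add: mult_right_mono)
    then have "\<bar>pert g (x \<eta>\<^sub>2 s) \<eta>\<^sub>2 \<epsilon> - pert g (x \<eta>\<^sub>1 s) \<eta>\<^sub>1 \<epsilon>\<bar> \<le> (R + 2 * L) * \<bar>x \<eta>\<^sub>2 s - x \<eta>\<^sub>1 s\<bar> + ?B"
      using abs_pert_diff_le[OF eta(2), of "x \<eta>\<^sub>2 s" "x \<eta>\<^sub>1 s"] by linarith
    from mult_left_mono[OF this, of "\<bar>\<epsilon>\<bar>"]
    show "\<bar>?r s\<bar> \<le> \<bar>\<epsilon>\<bar> * (R + 2 * L) * \<bar>x \<eta>\<^sub>2 s - x \<eta>\<^sub>1 s\<bar> + \<bar>\<epsilon>\<bar> * ?B"
      unfolding abs_mult abs_minus_cancel by (simp add: algebra_simps)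
  qed (use RL eps_force t x1 x2 constants_nonneg in simp_all)
  then show ?thesis by (simp add: Cpar_def algebra_simps)
qed

section \<open>The quotient and its iteration\<close>

definition Num :: "real \<Rightarrow> real" where "Num \<eta> = integral {0..2 * pi} (\<lambda>s. cos s * g (x \<eta> s))"
definition Den :: "real \<Rightarrow> real" where "Den \<eta> = integral {0..2 * pi} (\<lambda>s. cos s * x \<eta> s)"

lemma integrable_Num: "(\<lambda>s. cos s * g (x \<eta> s)) integrable_on {0..2 * pi}"
  by (intro integrable_continuous_interval continuous_intros continuous_on_g_x)

lemma integrable_Den: "(\<lambda>s. cos s * x \<eta> s) integrable_on {0..2 * pi}"
  by (intro integrable_continuous_interval continuous_intros continuous_on_x)

lemma Fquot_eq: "Fquot g a \<epsilon> \<eta> = Num \<eta> / Den \<eta>"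
  by (simp add: Fquot_def Num_def Den_def)

lemma abs_Num_le:
  assumes "\<bar>\<eta>\<bar> \<le> R"
  shows "\<bar>Num \<eta>\<bar> \<le> 2 * pi * gmax"
  unfolding Num_def
  by (rule abs_integral_cos_le[OF _ integrable_Num]) (use abs_g_le abs_x_le assms in blast)

text \<open>The main term is \<open>a \<integral>cos\<^sup>2 = \<pi>a\<close>, and the deviation of the solution from \<open>a cos\<close> changes it by at most
half of its size.\<close>

lemma abs_Den_ge:
  assumes "\<bar>\<eta>\<bar> \<le> R"
  shows "pi * \<bar>a\<bar> / 2 \<le> \<bar>Den \<eta>\<bar>"
proof -
  have cos: "((\<lambda>s. cos s * (a * cos s)) has_integral a * pi) {0..2 * pi}"
    using has_integral_mult_right[OF has_integral_cos_squared, of a] by (simp add: mult.left_commute)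
  have eq: "cos s * (x \<eta> s - a * cos s) = cos s * x \<eta> s - cos s * (a * cos s)" for s
    by (rule right_diff_distrib)
  have "Den \<eta> - a * pi = integral {0..2 * pi} (\<lambda>s. cos s * (x \<eta> s - a * cos s))"
    unfolding Den_def eq using integral_unique[OF cos] has_integral_integrable[OF cos] integrable_Den
    by (subst integral_diff) auto
  also have "\<bar>\<dots>\<bar> \<le> 2 * pi * (\<bar>\<epsilon>\<bar> * Ccos R)"
    by (rule abs_integral_cos_le)
      (use x_near_cos[OF assms] in \<open>auto intro!: integrable_continuous_interval continuous_intros continuous_on_x\<close>)
  also have "\<dots> \<le> 2 * pi * (\<bar>a\<bar> / 4)" using eps_denom by (intro mult_left_mono) auto
  finally show ?thesis
    using abs_triangle_ineq2[of "a * pi" "a * pi - Den \<eta>"] by (simp add: abs_mult abs_minus_commute mult.commute)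
qed

lemma Den_nonzero: "\<bar>\<eta>\<bar> \<le> R \<Longrightarrow> Den \<eta> \<noteq> 0"
proof
  assume "\<bar>\<eta>\<bar> \<le> R" "Den \<eta> = 0"
  then have "pi * \<bar>a\<bar> / 2 \<le> 0" using abs_Den_ge[of \<eta>] by simp
  moreover have "0 < pi * \<bar>a\<bar>" using a by (intro mult_pos_pos) auto
  ultimately show False by linarith
qed

lemma Fquot_well_defined: "\<bar>\<eta>\<bar> \<le> R \<Longrightarrow> Fquot_well_defined g a \<epsilon> \<eta>"
  unfolding Fquot_well_defined_def
  using solves_ivp_ex1[OF lip] integrable_Num integrable_Den Den_nonzero by (auto simp: Den_def)

lemma abs_Fquot_le:
  assumes "\<bar>\<eta>\<bar> \<le> R"
  shows "\<bar>Fquot g a \<epsilon> \<eta>\<bar> \<le> Fmax"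
proof -
  have "\<bar>Fquot g a \<epsilon> \<eta>\<bar> \<le> 2 * pi * gmax / (pi * \<bar>a\<bar> / 2)"
    unfolding Fquot_eq abs_divide
    using abs_Num_le[OF assms] abs_Den_ge[OF assms] a by (intro frac_le) auto
  then show ?thesis by (simp add: Fmax_def)
qed

lemma Fquot_lipschitz:
  assumes eta: "\<bar>\<eta>\<^sub>1\<bar> \<le> R" "\<bar>\<eta>\<^sub>2\<bar> \<le> R"
  shows "\<bar>Fquot g a \<epsilon> \<eta>\<^sub>2 - Fquot g a \<epsilon> \<eta>\<^sub>1\<bar> \<le> \<bar>\<epsilon>\<bar> * kappa * \<bar>\<eta>\<^sub>2 - \<eta>\<^sub>1\<bar>"
proof -
  define \<delta> where "\<delta> = \<bar>\<epsilon>\<bar> * Cpar * \<bar>\<eta>\<^sub>2 - \<eta>\<^sub>1\<bar>"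
  have \<delta>: "0 \<le> \<delta>" using constants_nonneg by (simp add: \<delta>_def)
  have xd: "\<bar>x \<eta>\<^sub>2 s - x \<eta>\<^sub>1 s\<bar> \<le> \<delta>" if "0 \<le> s" "s \<le> 2 * pi" for s
    unfolding \<delta>_def by (rule x_lipschitz_in_eta[OF eta that])
  have "Den \<eta>\<^sub>2 - Den \<eta>\<^sub>1 = integral {0..2 * pi} (\<lambda>s. cos s * (x \<eta>\<^sub>2 s - x \<eta>\<^sub>1 s))"
    unfolding Den_def right_diff_distrib by (simp add: integral_diff integrable_Den)
  also have "\<bar>\<dots>\<bar> \<le> 2 * pi * \<delta>"
    by (rule abs_integral_cos_le[OF xd])
      (auto intro!: integrable_continuous_interval continuous_intros continuous_on_x)
  finally have D: "\<bar>Den \<eta>\<^sub>2 - Den \<eta>\<^sub>1\<bar> \<le> 2 * pi * \<delta>" .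
  have gd: "\<bar>g (x \<eta>\<^sub>2 s) - g (x \<eta>\<^sub>1 s)\<bar> \<le> L * \<delta>" if "0 \<le> s" "s \<le> 2 * pi" for s
    using lip_abs[of "x \<eta>\<^sub>2 s" "x \<eta>\<^sub>1 s"] mult_left_mono[OF xd[OF that] constants_nonneg(1)] by linarith
  have "Num \<eta>\<^sub>2 - Num \<eta>\<^sub>1 = integral {0..2 * pi} (\<lambda>s. cos s * (g (x \<eta>\<^sub>2 s) - g (x \<eta>\<^sub>1 s)))"
    unfolding Num_def right_diff_distrib by (simp add: integral_diff integrable_Num)
  also have "\<bar>\<dots>\<bar> \<le> 2 * pi * (L * \<delta>)"
    by (rule abs_integral_cos_le[OF gd])
      (auto intro!: integrable_continuous_interval continuous_intros continuous_on_g_x)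
  finally have N: "\<bar>Num \<eta>\<^sub>2 - Num \<eta>\<^sub>1\<bar> \<le> 2 * pi * (L * \<delta>)" .
  \<comment> \<open>In this form only a bound of the first quotient and one denominator are left to estimate.\<close>
  have "Fquot g a \<epsilon> \<eta>\<^sub>2 - Fquot g a \<epsilon> \<eta>\<^sub>1 =
      ((Num \<eta>\<^sub>2 - Num \<eta>\<^sub>1) - Fquot g a \<epsilon> \<eta>\<^sub>1 * (Den \<eta>\<^sub>2 - Den \<eta>\<^sub>1)) / Den \<eta>\<^sub>2"
    using Den_nonzero[OF eta(1)] Den_nonzero[OF eta(2)] by (simp add: Fquot_eq field_simps)
  also have "\<bar>\<dots>\<bar> \<le> (2 * pi * (L * \<delta>) + Fmax * (2 * pi * \<delta>)) / (pi * \<bar>a\<bar> / 2)"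
    unfolding abs_divide
  proof (rule frac_le)
    have "\<bar>Fquot g a \<epsilon> \<eta>\<^sub>1 * (Den \<eta>\<^sub>2 - Den \<eta>\<^sub>1)\<bar> \<le> Fmax * (2 * pi * \<delta>)"
      unfolding abs_mult using D abs_Fquot_le[OF eta(1)] constants_nonneg by (intro mult_mono) auto
    then show "\<bar>(Num \<eta>\<^sub>2 - Num \<eta>\<^sub>1) - Fquot g a \<epsilon> \<eta>\<^sub>1 * (Den \<eta>\<^sub>2 - Den \<eta>\<^sub>1)\<bar>
        \<le> 2 * pi * (L * \<delta>) + Fmax * (2 * pi * \<delta>)"
      using N by linarith
    show "pi * \<bar>a\<bar> / 2 \<le> \<bar>Den \<eta>\<^sub>2\<bar>" by (rule abs_Den_ge[OF eta(2)])
  qed (use a \<delta> constants_nonneg in simp_all)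
  also have "\<dots> = \<bar>\<epsilon>\<bar> * kappa * \<bar>\<eta>\<^sub>2 - \<eta>\<^sub>1\<bar>"
    using a by (simp add: kappa_def \<delta>_def field_simps)
  finally show ?thesis .
qed

lemma velocity_zero_iff:
  assumes eta: "\<bar>\<eta>\<bar> \<le> R"
    and x': "second_order_derivs (x \<eta>) x' (\<lambda>t. - x \<eta> t - \<epsilon> * pert g (x \<eta> t) \<eta> \<epsilon>)" "x' 0 = 0"
  shows "x' (2 * pi) = 0 \<longleftrightarrow> \<eta> = (1 - \<epsilon> * \<eta>) * Fquot g a \<epsilon> \<eta>"
proof -
  have eq: "(\<lambda>s. - \<epsilon> * (cos s * pert g (x \<eta> s) \<eta> \<epsilon>)) =
      (\<lambda>s. - \<epsilon> * ((1 - \<epsilon> * \<eta>) * (cos s * g (x \<eta> s)) - \<eta> * (cos s * x \<eta> s)))"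
    by (auto simp: pert_def algebra_simps)
  have "((\<lambda>s. - \<epsilon> * (cos s * pert g (x \<eta> s) \<eta> \<epsilon>)) has_integral
      - \<epsilon> * ((1 - \<epsilon> * \<eta>) * Num \<eta> - \<eta> * Den \<eta>)) {0..2 * pi}"
    unfolding eq Num_def Den_def
    by (intro has_integral_mult_right has_integral_diff integrable_integral integrable_Num integrable_Den)
  from has_integral_unique[OF resonance_identity[OF x'] this]
  have "x' (2 * pi) = - \<epsilon> * ((1 - \<epsilon> * \<eta>) * Num \<eta> - \<eta> * Den \<eta>)" .
  then have "x' (2 * pi) = 0 \<longleftrightarrow> (1 - \<epsilon> * \<eta>) * Num \<eta> = \<eta> * Den \<eta>" using eps by simp
  also have "\<dots> \<longleftrightarrow> \<eta> = (1 - \<epsilon> * \<eta>) * Fquot g a \<epsilon> \<eta>"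
    using Den_nonzero[OF eta] by (auto simp: Fquot_eq field_simps)
  finally show ?thesis .
qed

text \<open>Vanishing velocity at \<open>2\<pi>\<close> implies that the position returns as well, since every point \<open>y\<close> between \<open>a\<close> and
\<open>x\<^sub>\<eta>(2\<pi>)\<close> is so close to \<open>a\<close> that \<open>y + \<epsilon> g(y)\<close> cannot vanish. The solution shifted by \<open>2\<pi>\<close> then solves the
same initial value problem.\<close>

lemma periodic_iff:
  assumes eta: "\<bar>\<eta>\<bar> \<le> R"
  shows "has_period (2 * pi) (x \<eta>) \<longleftrightarrow> \<eta> = (1 - \<epsilon> * \<eta>) * Fquot g a \<epsilon> \<eta>"
proof -
  obtain x' where x': "second_order_derivs (x \<eta>) x' (\<lambda>t. - x \<eta> t - \<epsilon> * pert g (x \<eta> t) \<eta> \<epsilon>)"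
    "x \<eta> 0 = a" "x' 0 = 0"
    by (rule solution)
  have "has_period (2 * pi) (x \<eta>) \<longleftrightarrow> x' (2 * pi) = 0"
  proof
    assume "has_period (2 * pi) (x \<eta>)"
    then have per: "(\<lambda>t. x \<eta> (t + 2 * pi)) = x \<eta>" by (simp add: has_period_def)
    have "(x \<eta> has_real_derivative x' (2 * pi)) (at (0 + 2 * pi))" "(x \<eta> has_real_derivative x' 0) (at 0)"
      using x'(1) by (simp_all add: second_order_derivs_def)
    then have "x' (2 * pi) = x' 0" unfolding DERIV_shift per by (rule DERIV_unique)
    with x' show "x' (2 * pi) = 0" by simp
  next
    assume v: "x' (2 * pi) = 0"
    have near: "\<bar>x \<eta> (2 * pi) - a\<bar> \<le> \<bar>\<epsilon>\<bar> * Ccos R" using x_near_cos[OF eta, of "2 * pi"] by simp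
    have "x \<eta> (2 * pi) = x \<eta> 0"
    proof (rule returns_if_velocity_zero[OF continuous_on_g x'(1,3) v])
      show "\<epsilon> * \<eta> \<noteq> 1" using abs_eps_eta[OF eta] by auto
    next
      fix y assume "y \<in> closed_segment (x \<eta> 0) (x \<eta> (2 * pi))"
      then have y: "\<bar>y - a\<bar> \<le> \<bar>\<epsilon>\<bar> * Ccos R"
        using near by (auto simp: x' closed_segment_eq_real_ivl split: if_splits)
      then have "\<bar>y\<bar> \<le> amp" using eps_amp unfolding amp_def by linarith
      then have "\<bar>\<epsilon> * g y\<bar> \<le> \<bar>\<epsilon>\<bar> * gmax" by (simp add: abs_mult abs_g_le mult_left_mono)
      then show "y + \<epsilon> * g y \<noteq> 0" using y eps_energy unfolding distrib_left by linarith
    qed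
    then have "solves_ivp g a \<epsilon> \<eta> (\<lambda>t. x \<eta> (t + 2 * pi))"
      using x' v by (intro solves_ivp_shift[OF x'(1)]) auto
    from sol_eqI[OF lip this] show "has_period (2 * pi) (x \<eta>)"
      unfolding has_period_def by (metis)
  qed
  also have "\<dots> \<longleftrightarrow> \<eta> = (1 - \<epsilon> * \<eta>) * Fquot g a \<epsilon> \<eta>" by (rule velocity_zero_iff[OF eta x'(1,3)])
  finally show ?thesis .
qed

definition \<Phi> :: "real \<Rightarrow> real" where "\<Phi> \<eta> = (1 - \<epsilon> * \<eta>) * Fquot g a \<epsilon> \<eta>"

lemma abs_Phi_le:
  assumes "\<bar>\<eta>\<bar> \<le> R"
  shows "\<bar>\<Phi> \<eta>\<bar> \<le> R"
proof -
  have "\<bar>1 - \<epsilon> * \<eta>\<bar> \<le> 2" using abs_eps_eta[OF assms] by linarith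
  then have "\<bar>\<Phi> \<eta>\<bar> \<le> 2 * Fmax"
    unfolding \<Phi>_def abs_mult using abs_Fquot_le[OF assms] by (intro mult_mono) auto
  with R show ?thesis by simp
qed

lemma Phi_contraction:
  assumes eta: "\<bar>\<eta>\<^sub>2\<bar> \<le> R" "\<bar>\<eta>\<^sub>1\<bar> \<le> R"
  shows "\<bar>\<Phi> \<eta>\<^sub>2 - \<Phi> \<eta>\<^sub>1\<bar> \<le> 1 / 2 * \<bar>\<eta>\<^sub>2 - \<eta>\<^sub>1\<bar>"
proof -
  let ?F = "Fquot g a \<epsilon>"
  have 1: "\<bar>1 - \<epsilon> * \<eta>\<^sub>2\<bar> \<le> 2" using abs_eps_eta[OF eta(1)] by linarith
  have "\<Phi> \<eta>\<^sub>2 - \<Phi> \<eta>\<^sub>1 = (1 - \<epsilon> * \<eta>\<^sub>2) * (?F \<eta>\<^sub>2 - ?F \<eta>\<^sub>1) - \<epsilon> * (\<eta>\<^sub>2 - \<eta>\<^sub>1) * ?F \<eta>\<^sub>1"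
    by (simp add: \<Phi>_def algebra_simps)
  also have "\<bar>\<dots>\<bar> \<le> \<bar>1 - \<epsilon> * \<eta>\<^sub>2\<bar> * \<bar>?F \<eta>\<^sub>2 - ?F \<eta>\<^sub>1\<bar> + \<bar>\<epsilon>\<bar> * \<bar>\<eta>\<^sub>2 - \<eta>\<^sub>1\<bar> * \<bar>?F \<eta>\<^sub>1\<bar>"
    unfolding abs_mult[symmetric] by linarith
  also have "\<dots> \<le> 2 * (\<bar>\<epsilon>\<bar> * kappa * \<bar>\<eta>\<^sub>2 - \<eta>\<^sub>1\<bar>) + \<bar>\<epsilon>\<bar> * \<bar>\<eta>\<^sub>2 - \<eta>\<^sub>1\<bar> * Fmax"
    using 1 Fquot_lipschitz[OF eta(2,1)] abs_Fquot_le[OF eta(2)] by (intro add_mono mult_mono) auto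
  also have "\<dots> = \<bar>\<epsilon>\<bar> * (Fmax + 2 * kappa) * \<bar>\<eta>\<^sub>2 - \<eta>\<^sub>1\<bar>" by (simp add: algebra_simps)
  also have "\<dots> \<le> 1 / 2 * \<bar>\<eta>\<^sub>2 - \<eta>\<^sub>1\<bar>" using eps_contr by (rule mult_right_mono) simp
  finally show ?thesis .
qed

lemma iteration_converges:
  assumes "\<bar>h 0\<bar> \<le> R" and h: "\<And>j. h (Suc j) = \<Phi> (h j)"
  shows "\<bar>h j\<bar> \<le> R" and "\<exists>\<eta>. \<bar>\<eta>\<bar> \<le> R \<and> h \<longlonglongrightarrow> \<eta> \<and> has_period (2 * pi) (x \<eta>)"
proof -
  have S: "y \<in> {-R..R} \<longleftrightarrow> \<bar>y\<bar> \<le> R" for y by auto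
  have "complete {-R..R}" by (simp add: compact_imp_complete)
  note * = iterates_converge_to_fixed_point[OF this, of h \<Phi> "1 / 2", unfolded S,
      OF assms(1) abs_Phi_le Phi_contraction _ _ h]
  show "\<bar>h j\<bar> \<le> R" using *(1) by simp
  obtain \<eta> where "\<bar>\<eta>\<bar> \<le> R" "\<Phi> \<eta> = \<eta>" "h \<longlonglongrightarrow> \<eta>" using *(2) S by auto
  then show "\<exists>\<eta>. \<bar>\<eta>\<bar> \<le> R \<and> h \<longlonglongrightarrow> \<eta> \<and> has_period (2 * pi) (x \<eta>)"
    using periodic_iff unfolding \<Phi>_def by metis
qed

end

section \<open>Return to the original time scale\<close>

text \<open>Since \<open>pert\<close> combines with the linear term to \<open>x'' + (1 - \<epsilon>\<eta>) (x + \<epsilon> g(x)) = 0\<close>, the choice of \<open>w\<close> makes the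
time change remove the parameter \<open>\<eta>\<close> from the equation.\<close>

lemma solves_oscillator_rescaled:
  assumes x: "solves_ivp g a \<epsilon> \<eta> x" and m: "m > 0" and \<omega>: "\<omega>\<^sup>2 = k / m"
    and w: "w\<^sup>2 * (1 - \<epsilon> * \<eta>) = \<omega>\<^sup>2"
  shows "solves_oscillator m k g \<epsilon> (\<lambda>t. x (w * t))"
proof -
  obtain x' where x': "second_order_derivs x x' (\<lambda>t. - x t - \<epsilon> * pert g (x t) \<eta> \<epsilon>)"
    using x by (rule solves_ivpE)
  define x'' where "x'' t = - x t - \<epsilon> * pert g (x t) \<eta> \<epsilon>" for t
  have der: "(x has_real_derivative x' t) (at t)" "(x' has_real_derivative x'' t) (at t)" for t
    using x' by (auto simp: second_order_derivs_def x''_def)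
  have "second_order_derivs (\<lambda>t. x (w * t)) (\<lambda>t. w * x' (w * t)) (\<lambda>t. w\<^sup>2 * x'' (w * t))"
    unfolding second_order_derivs_def
  proof (intro allI conjI)
    fix t
    have lin: "((\<lambda>t. w * t) has_real_derivative w) (at t)" by (auto intro!: derivative_eq_intros)
    show "((\<lambda>t. x (w * t)) has_real_derivative w * x' (w * t)) (at t)"
      using DERIV_chain2[OF der(1) lin] by (simp add: mult.commute)
    show "((\<lambda>t. w * x' (w * t)) has_real_derivative w\<^sup>2 * x'' (w * t)) (at t)"
      using DERIV_cmult[OF DERIV_chain2[OF der(2) lin], of w]
      by (simp add: power2_eq_square ac_simps)
  qed
  moreover have "m * (w\<^sup>2 * x'' t) + k * x t + \<epsilon> * k * g (x t) = 0" for t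
  proof -
    have "w\<^sup>2 * x'' t = - (w\<^sup>2 * (1 - \<epsilon> * \<eta>)) * (x t + \<epsilon> * g (x t))"
      by (simp add: x''_def pert_def algebra_simps)
    then have "m * (w\<^sup>2 * x'' t) = - k * (x t + \<epsilon> * g (x t))"
      unfolding w \<omega> using m by simp
    then show ?thesis by (simp add: algebra_simps)
  qed
  ultimately show ?thesis unfolding solves_oscillator_def by blast
qed

theorem proposition4p1:
  fixes m k\<^sub>0 \<omega> a :: real and g :: "real \<Rightarrow> real"
  assumes "m > 0" and "k\<^sub>0 > 0" and "\<omega>\<^sup>2 = k\<^sub>0 / m"
    and "\<exists>L. L-lipschitz_on UNIV g"
    and "a \<noteq> 0"
  shows "\<exists>R\<^sub>0>0. \<forall>R\<ge>R\<^sub>0. \<exists>\<epsilon>\<^sub>0>0. \<exists>\<kappa>::real. \<forall>\<epsilon>. 0 < \<bar>\<epsilon>\<bar> \<and> \<bar>\<epsilon>\<bar> \<le> \<epsilon>\<^sub>0 \<longrightarrow>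
      (\<forall>\<eta>\<in>{-R..R}. Fquot_well_defined g a \<epsilon> \<eta>) \<and>
      (\<forall>\<eta>. \<bar>\<eta>\<bar> \<le> R \<and> has_period (2 * pi) (sol g a \<epsilon> \<eta>) \<longrightarrow>
         \<eta> = (1 - \<epsilon> * \<eta>) * Fquot g a \<epsilon> \<eta>) \<and>
      (\<forall>\<eta>\<^sub>1\<in>{-R..R}. \<forall>\<eta>\<^sub>2\<in>{-R..R}.
         \<bar>Fquot g a \<epsilon> \<eta>\<^sub>2 - Fquot g a \<epsilon> \<eta>\<^sub>1\<bar> \<le> \<bar>\<epsilon>\<bar> * \<kappa> * \<bar>\<eta>\<^sub>2 - \<eta>\<^sub>1\<bar>) \<and>
      (\<forall>h::nat \<Rightarrow> real.
         h 0 \<in> {-R..R} \<and> (\<forall>j. h (Suc j) = (1 - \<epsilon> * h j) * Fquot g a \<epsilon> (h j)) \<longrightarrow>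
         (\<forall>j. Fquot_well_defined g a \<epsilon> (h j)) \<and>
         (\<exists>\<eta>. h \<longlonglongrightarrow> \<eta> \<and>
            has_period (2 * pi) (sol g a \<epsilon> \<eta>) \<and>
            (\<exists>\<omega>\<^sub>\<epsilon>>0. 1 / \<omega>\<^sub>\<epsilon>\<^sup>2 = (1 - \<epsilon> * \<eta>) / \<omega>\<^sup>2 \<and>
               solves_oscillator m k\<^sub>0 g \<epsilon> (\<lambda>t. sol g a \<epsilon> \<eta> (\<omega>\<^sub>\<epsilon> * t)) \<and>
               has_period (2 * pi / \<omega>\<^sub>\<epsilon>) (\<lambda>t. sol g a \<epsilon> \<eta> (\<omega>\<^sub>\<epsilon> * t)))))"
proof -
  obtain L where "L-lipschitz_on UNIV g" using assms(4) by blast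
  then interpret lipschitz_nonlinearity g L a using assms(5) by unfold_locales
  have \<omega>: "\<omega>\<^sup>2 > 0" using assms(1-3) by simp
  show ?thesis
  proof (rule exI[of _ "2 * Fmax + 1"], intro conjI allI impI)
    show "0 < 2 * Fmax + 1" using constants_nonneg by simp
  next
    fix R assume "2 * Fmax + 1 \<le> R"
    then have "0 \<le> R" "2 * Fmax \<le> R" using constants_nonneg(5) by auto
    from eventually_weak_coupling[OF this]
    obtain \<epsilon>\<^sub>0 where \<epsilon>\<^sub>0: "0 < \<epsilon>\<^sub>0" and weak: "\<And>\<epsilon>. 0 < \<bar>\<epsilon>\<bar> \<and> \<bar>\<epsilon>\<bar> \<le> \<epsilon>\<^sub>0 \<Longrightarrow> weak_coupling g L a R \<epsilon>"
      by blast
    show "\<exists>\<epsilon>\<^sub>0>0. \<exists>\<kappa>::real. \<forall>\<epsilon>. 0 < \<bar>\<epsilon>\<bar> \<and> \<bar>\<epsilon>\<bar> \<le> \<epsilon>\<^sub>0 \<longrightarrow>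
      (\<forall>\<eta>\<in>{-R..R}. Fquot_well_defined g a \<epsilon> \<eta>) \<and>
      (\<forall>\<eta>. \<bar>\<eta>\<bar> \<le> R \<and> has_period (2 * pi) (sol g a \<epsilon> \<eta>) \<longrightarrow>
         \<eta> = (1 - \<epsilon> * \<eta>) * Fquot g a \<epsilon> \<eta>) \<and>
      (\<forall>\<eta>\<^sub>1\<in>{-R..R}. \<forall>\<eta>\<^sub>2\<in>{-R..R}.
         \<bar>Fquot g a \<epsilon> \<eta>\<^sub>2 - Fquot g a \<epsilon> \<eta>\<^sub>1\<bar> \<le> \<bar>\<epsilon>\<bar> * \<kappa> * \<bar>\<eta>\<^sub>2 - \<eta>\<^sub>1\<bar>) \<and>
      (\<forall>h::nat \<Rightarrow> real.
         h 0 \<in> {-R..R} \<and> (\<forall>j. h (Suc j) = (1 - \<epsilon> * h j) * Fquot g a \<epsilon> (h j)) \<longrightarrow>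
         (\<forall>j. Fquot_well_defined g a \<epsilon> (h j)) \<and>
         (\<exists>\<eta>. h \<longlonglongrightarrow> \<eta> \<and>
            has_period (2 * pi) (sol g a \<epsilon> \<eta>) \<and>
            (\<exists>\<omega>\<^sub>\<epsilon>>0. 1 / \<omega>\<^sub>\<epsilon>\<^sup>2 = (1 - \<epsilon> * \<eta>) / \<omega>\<^sup>2 \<and>
               solves_oscillator m k\<^sub>0 g \<epsilon> (\<lambda>t. sol g a \<epsilon> \<eta> (\<omega>\<^sub>\<epsilon> * t)) \<and>
               has_period (2 * pi / \<omega>\<^sub>\<epsilon>) (\<lambda>t. sol g a \<epsilon> \<eta> (\<omega>\<^sub>\<epsilon> * t)))))"
    proof (rule exI[of _ \<epsilon>\<^sub>0], rule conjI[OF \<epsilon>\<^sub>0], rule exI[of _ kappa], rule allI, rule impI)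
      fix \<epsilon> assume "0 < \<bar>\<epsilon>\<bar> \<and> \<bar>\<epsilon>\<bar> \<le> \<epsilon>\<^sub>0"
      then interpret weak_coupling g L a R \<epsilon> by (rule weak)
      have "(\<forall>j. Fquot_well_defined g a \<epsilon> (h j)) \<and>
         (\<exists>\<eta>. h \<longlonglongrightarrow> \<eta> \<and>
            has_period (2 * pi) (sol g a \<epsilon> \<eta>) \<and>
            (\<exists>\<omega>\<^sub>\<epsilon>>0. 1 / \<omega>\<^sub>\<epsilon>\<^sup>2 = (1 - \<epsilon> * \<eta>) / \<omega>\<^sup>2 \<and>
               solves_oscillator m k\<^sub>0 g \<epsilon> (\<lambda>t. sol g a \<epsilon> \<eta> (\<omega>\<^sub>\<epsilon> * t)) \<and>
               has_period (2 * pi / \<omega>\<^sub>\<epsilon>) (\<lambda>t. sol g a \<epsilon> \<eta> (\<omega>\<^sub>\<epsilon> * t))))"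
        if h: "h 0 \<in> {-R..R}" "\<forall>j. h (Suc j) = (1 - \<epsilon> * h j) * Fquot g a \<epsilon> (h j)" for h :: "nat \<Rightarrow> real"
      proof
        have h': "\<bar>h 0\<bar> \<le> R" "\<And>j. h (Suc j) = \<Phi> (h j)" using h by (auto simp: \<Phi>_def)
        show "\<forall>j. Fquot_well_defined g a \<epsilon> (h j)"
          using Fquot_well_defined iteration_converges(1)[of h, OF h'] by blast
        obtain \<eta> where \<eta>: "\<bar>\<eta>\<bar> \<le> R" "h \<longlonglongrightarrow> \<eta>" "has_period (2 * pi) (sol g a \<epsilon> \<eta>)"
          using iteration_converges(2)[of h, OF h'] by blast
        define w where "w = sqrt (\<omega>\<^sup>2 / (1 - \<epsilon> * \<eta>))"
        have pos: "1 - \<epsilon> * \<eta> > 0" using abs_eps_eta[OF \<eta>(1)] by linarith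
        have w: "w > 0" "w\<^sup>2 = \<omega>\<^sup>2 / (1 - \<epsilon> * \<eta>)" using \<omega> pos by (simp_all add: w_def)
        have "solves_oscillator m k\<^sub>0 g \<epsilon> (\<lambda>t. sol g a \<epsilon> \<eta> (w * t))"
          by (rule solves_oscillator_rescaled[OF sol_solves_ivp[OF lip] assms(1,3)]) (use w pos in simp)
        moreover have "1 / w\<^sup>2 = (1 - \<epsilon> * \<eta>) / \<omega>\<^sup>2" by (simp add: w)
        moreover have "has_period (2 * pi / w) (\<lambda>t. sol g a \<epsilon> \<eta> (w * t))"
          using \<eta>(3) w(1) by (simp add: has_period_def distrib_left)
        ultimately show "\<exists>\<eta>. h \<longlonglongrightarrow> \<eta> \<and>
            has_period (2 * pi) (sol g a \<epsilon> \<eta>) \<and>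
            (\<exists>\<omega>\<^sub>\<epsilon>>0. 1 / \<omega>\<^sub>\<epsilon>\<^sup>2 = (1 - \<epsilon> * \<eta>) / \<omega>\<^sup>2 \<and>
               solves_oscillator m k\<^sub>0 g \<epsilon> (\<lambda>t. sol g a \<epsilon> \<eta> (\<omega>\<^sub>\<epsilon> * t)) \<and>
               has_period (2 * pi / \<omega>\<^sub>\<epsilon>) (\<lambda>t. sol g a \<epsilon> \<eta> (\<omega>\<^sub>\<epsilon> * t)))"
          using \<eta> w(1) by blast
      qed
      moreover have "\<forall>\<eta>\<in>{-R..R}. Fquot_well_defined g a \<epsilon> \<eta>"
        using Fquot_well_defined by auto
      moreover have "\<forall>\<eta>. \<bar>\<eta>\<bar> \<le> R \<and> has_period (2 * pi) (sol g a \<epsilon> \<eta>) \<longrightarrow>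
         \<eta> = (1 - \<epsilon> * \<eta>) * Fquot g a \<epsilon> \<eta>"
        using periodic_iff by blast
      moreover have "\<forall>\<eta>\<^sub>1\<in>{-R..R}. \<forall>\<eta>\<^sub>2\<in>{-R..R}.
         \<bar>Fquot g a \<epsilon> \<eta>\<^sub>2 - Fquot g a \<epsilon> \<eta>\<^sub>1\<bar> \<le> \<bar>\<epsilon>\<bar> * kappa * \<bar>\<eta>\<^sub>2 - \<eta>\<^sub>1\<bar>"
        using Fquot_lipschitz by auto
      ultimately show "(\<forall>\<eta>\<in>{-R..R}. Fquot_well_defined g a \<epsilon> \<eta>) \<and>
        (\<forall>\<eta>. \<bar>\<eta>\<bar> \<le> R \<and> has_period (2 * pi) (sol g a \<epsilon> \<eta>) \<longrightarrow>
           \<eta> = (1 - \<epsilon> * \<eta>) * Fquot g a \<epsilon> \<eta>) \<and>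
        (\<forall>\<eta>\<^sub>1\<in>{-R..R}. \<forall>\<eta>\<^sub>2\<in>{-R..R}.
           \<bar>Fquot g a \<epsilon> \<eta>\<^sub>2 - Fquot g a \<epsilon> \<eta>\<^sub>1\<bar> \<le> \<bar>\<epsilon>\<bar> * kappa * \<bar>\<eta>\<^sub>2 - \<eta>\<^sub>1\<bar>) \<and>
        (\<forall>h::nat \<Rightarrow> real.
           h 0 \<in> {-R..R} \<and> (\<forall>j. h (Suc j) = (1 - \<epsilon> * h j) * Fquot g a \<epsilon> (h j)) \<longrightarrow>
           (\<forall>j. Fquot_well_defined g a \<epsilon> (h j)) \<and>
           (\<exists>\<eta>. h \<longlonglongrightarrow> \<eta> \<and>
              has_period (2 * pi) (sol g a \<epsilon> \<eta>) \<and>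
              (\<exists>\<omega>\<^sub>\<epsilon>>0. 1 / \<omega>\<^sub>\<epsilon>\<^sup>2 = (1 - \<epsilon> * \<eta>) / \<omega>\<^sup>2 \<and>
                 solves_oscillator m k\<^sub>0 g \<epsilon> (\<lambda>t. sol g a \<epsilon> \<eta> (\<omega>\<^sub>\<epsilon> * t)) \<and>
                 has_period (2 * pi / \<omega>\<^sub>\<epsilon>) (\<lambda>t. sol g a \<epsilon> \<eta> (\<omega>\<^sub>\<epsilon> * t)))))"
        by blast
    qed
  qed
qed

end
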